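(* The type-structure $\mathcal C^{=}=(\mathcal C^=_\sigma)_\sigma$, where $\mathcal C^=_\sigma:=\{x\in\mathcal S_\sigma:\ \mathcal S^\omega_*\models\exists\boldsymbol a\,\forall\boldsymbol b\,\langle\mathcal I_\sigma(x)\rangle^{\boldsymbol a}_{\boldsymbol b}\}$ with $\langle\cdot\rangle$ the canonical-upon-precise interpretation, is a model of Gödel's theory $\mathsf T$.
   Context: Types: finite types are generated by $\sigma\to\tau$ from the ground types $\mathbb N$, $\mathbb B$ (Booleans); star types allow in addition $\sigma\mapsto\sigma^*$. $\mathcal S^\omega_*$ is the full set-theoretic structure: $\mathcal S_{\mathbb N}=\mathbb N$, $\mathcal S_{\mathbb B}=\{0,1\}$, $\mathcal S_{\rho\to\sigma}$ is the set of all functions from $\mathcal S_\rho$ to $\mathcal S_\sigma$, $\mathcal S_{\sigma^*}$ the set of all non-empty finite subsets of $\mathcal S_\sigma$. Boldface letters are (possibly empty) tuples; $\forall\boldsymbol b\in\boldsymbol B$ means $\forall b_1\in B_1\cdots\forall b_n\in B_n$. For each finite type $\sigma$, tuples of star types $\boldsymbol\tau_\sigma^+,\boldsymbol\tau_\sigma^-$ and the relation $\langle\mathcal I_\sigma(x)\rangle^{\boldsymbol a}_{\boldsymbol b}$ ($x:\sigma$, $\boldsymbol a:\boldsymbol\tau_\sigma^+$, $\boldsymbol b:\boldsymbol\tau_\sigma^-$) are defined by recursion: $\langle\mathcal I_{\mathbb N}(x)\rangle^n$ is $x=n$ ($\tau^+_{\mathbb N}=\mathbb N$, $\boldsymbol\tau^-_{\mathbb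 N}$ empty); $\langle\mathcal I_{\mathbb B}(i)\rangle^j$ is $i=j$ ($\tau^+_{\mathbb B}=\mathbb B$, $\boldsymbol\tau^-_{\mathbb B}$ empty); and $$\langle\mathcal I_{\rho\to\sigma}(h)\rangle^{\boldsymbol f,\boldsymbol g}_{\boldsymbol a,\boldsymbol d}:\equiv\forall x^\rho(\forall\boldsymbol b\in\boldsymbol g\boldsymbol a\boldsymbol d\,\langle\mathcal I_\rho(x)\rangle^{\boldsymbol a}_{\boldsymbol b}\to\langle\mathcal I_\sigma(hx)\rangle^{\boldsymbol f\boldsymbol a}_{\boldsymbol d}),$$ where $\boldsymbol a:\boldsymbol\tau^+_\rho$, $\boldsymbol d:\boldsymbol\tau^-_\sigma$, $\boldsymbol f$ maps $\boldsymbol\tau_\rho^+$ to $\boldsymbol\tau_\sigma^+$, and $\boldsymbol g$ maps $\boldsymbol\tau_\rho^+,\boldsymbol\tau_\sigma^-$ to tuples of non-empty finite sets of elements of the types $\boldsymbol\tau_\rho^-$. Gödel's $\mathsf T$ is the quantifier-free theory of primitive recursive functionals over the arithmetical types (generated from $\mathbb N$ by $\to$), with constants the combinators $\Pi,\Sigma$, $0$, successor $\mathsf S$ and recursors $\mathsf R_\sigma$ ($\mathsf R0wf=w$, $\mathsf R(\mathsf Sn)wf=fn(\mathsf Rnwf)$). That a family $\mathcal C_\sigma\subseteq\mathcal S_\sigma$ is a model of $\mathsf T$ means: $\mathcal C_{\mathbb N}=\mathbb N$, the family is closed under application and contains the set-theoretic combinators, zero, successor and recursors of arithmetical type, which interpret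 the constants of $\mathsf T$ (so that the axioms of $\mathsf T$ hold). *)

theory Defs
  imports "HOL-Library.FuncSet"
begin

datatype fty = NatT | BoolT | FunT fty fty (infixr \<open>\<rightarrow>\<^sub>f\<close> 65)

datatype sty = NatS | BoolS | FunS sty sty (infixr \<open>\<rightarrow>\<^sub>s\<close> 65) | Star sty

primrec sty_of :: "fty \<Rightarrow> sty" where
  "sty_of NatT = NatS"
| "sty_of BoolT = BoolS"
| "sty_of (\<rho> \<rightarrow>\<^sub>f \<sigma>) = sty_of \<rho> \<rightarrow>\<^sub>s sty_of \<sigma>"

primrec arithmetical :: "fty \<Rightarrow> bool" where
  "arithmetical NatT \<longleftrightarrow> True"
| "arithmetical BoolT \<longleftrightarrow> False"
| "arithmetical (\<rho> \<rightarrow>\<^sub>f \<sigma>) \<longleftrightarrow> arithmetical \<rho> \<and> arithmetical \<sigma>"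

text \<open>
  The full set-theoretic structure over the star types is described up to isomorphism on an
  arbitrary type of codes: \<open>carr M \<tau>\<close> is the set of (codes of) objects of type \<open>\<tau>\<close>, and
  \<open>appl\<close> and \<open>elts\<close> decode functions and finite sets, and \<open>num_val\<close> and \<open>bool_val\<close> encode numbers
  and Booleans.

  The union of the carriers over all star types has cardinality beth-omega, and HOL alone does
  not prove that some type is that large.  Therefore the structure also records the set
  \<open>types M\<close> of star types for which full carriers are present, which has to be closed under
  subtypes.  The structure with all types is the case \<open>types M = UNIV\<close>; every fragment with a
  finite set of types is realised by an HOL type (see \<open>full_structure_base\<close>,
  \<open>full_structure_fun\<close> and \<open>full_structure_star\<close> below).
\<close>

record 'u type_structure =
  types :: "sty set"
  carr :: "sty \<Rightarrow> 'u set"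
  appl :: "'u \<Rightarrow> 'u \<Rightarrow> 'u"
  elts :: "'u \<Rightarrow> 'u set"
  num_val :: "nat \<Rightarrow> 'u"
  bool_val :: "bool \<Rightarrow> 'u"

definition full_structure :: "'u type_structure \<Rightarrow> bool" where
  "full_structure M \<longleftrightarrow>
     NatS \<in> types M \<and> BoolS \<in> types M \<and>
     (\<forall>\<rho> \<sigma>. \<rho> \<rightarrow>\<^sub>s \<sigma> \<in> types M \<longrightarrow> \<rho> \<in> types M \<and> \<sigma> \<in> types M) \<and>
     (\<forall>\<sigma>. Star \<sigma> \<in> types M \<longrightarrow> \<sigma> \<in> types M) \<and>
     bij_betw (num_val M) UNIV (carr M NatS) \<and>
     bij_betw (bool_val M) UNIV (carr M BoolS) \<and>
     (\<forall>\<rho> \<sigma>. \<rho> \<rightarrow>\<^sub>s \<sigma> \<in> types M \<longrightarrow>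
        bij_betw (\<lambda>h. restrict (appl M h) (carr M \<rho>))
          (carr M (\<rho> \<rightarrow>\<^sub>s \<sigma>)) (carr M \<rho> \<rightarrow>\<^sub>E carr M \<sigma>)) \<and>
     (\<forall>\<sigma>. Star \<sigma> \<in> types M \<longrightarrow>
        bij_betw (elts M) (carr M (Star \<sigma>)) {A. A \<subseteq> carr M \<sigma> \<and> finite A \<and> A \<noteq> {}})"

text \<open>
  Tuples are lists, tuples of types are lists of types, and functions of a tuple are curried:
  \<open>funs [\<tau>\<^sub>1, \<dots>, \<tau>\<^sub>n] \<gamma>\<close> is \<open>\<tau>\<^sub>1 \<rightarrow>\<^sub>s \<dots> \<rightarrow>\<^sub>s \<tau>\<^sub>n \<rightarrow>\<^sub>s \<gamma>\<close>.
\<close>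

abbreviation funs :: "sty list \<Rightarrow> sty \<Rightarrow> sty" where
  "funs \<tau>s \<gamma> \<equiv> foldr FunS \<tau>s \<gamma>"

definition tuples :: "'u type_structure \<Rightarrow> sty list \<Rightarrow> 'u list set" where
  "tuples M \<tau>s = listset (map (carr M) \<tau>s)"

abbreviation appls :: "'u type_structure \<Rightarrow> 'u \<Rightarrow> 'u list \<Rightarrow> 'u" where
  "appls M h as \<equiv> foldl (appl M) h as"

fun tpos :: "fty \<Rightarrow> sty list" and tneg :: "fty \<Rightarrow> sty list" where
  "tpos NatT = [NatS]"
| "tneg NatT = []"
| "tpos BoolT = [BoolS]"
| "tneg BoolT = []"
| "tpos (\<rho> \<rightarrow>\<^sub>f \<sigma>) = map (funs (tpos \<rho>)) (tpos \<sigma>)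
      @ map (\<lambda>\<beta>. funs (tpos \<rho> @ tneg \<sigma>) (Star \<beta>)) (tneg \<rho>)"
| "tneg (\<rho> \<rightarrow>\<^sub>f \<sigma>) = tpos \<rho> @ tneg \<sigma>"

text \<open>
  At a function type the upper tuple is split into \<open>f\<close> (as long as \<open>tpos \<sigma>\<close>) and \<open>g\<close>, and the
  lower tuple into \<open>a\<close> (as long as \<open>tpos \<rho>\<close>) and \<open>d\<close>.
\<close>

primrec interp :: "'u type_structure \<Rightarrow> fty \<Rightarrow> 'u \<Rightarrow> 'u list \<Rightarrow> 'u list \<Rightarrow> bool" where
  "interp M NatT x as bs \<longleftrightarrow> as = [x] \<and> bs = []"
| "interp M BoolT x as bs \<longleftrightarrow> as = [x] \<and> bs = []"
| "interp M (\<rho> \<rightarrow>\<^sub>f \<sigma>) h as bs \<longleftrightarrow>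
     (let f = take (length (tpos \<sigma>)) as; g = drop (length (tpos \<sigma>)) as;
          a = take (length (tpos \<rho>)) bs; d = drop (length (tpos \<rho>)) bs
      in \<forall>x\<in>carr M (sty_of \<rho>).
           (\<forall>b\<in>listset (map (\<lambda>g\<^sub>i. elts M (appls M g\<^sub>i (a @ d))) g). interp M \<rho> x a b) \<longrightarrow>
           interp M \<sigma> (appl M h x) (map (\<lambda>f\<^sub>i. appls M f\<^sub>i a) f) d)"

definition C_eq :: "'u type_structure \<Rightarrow> fty \<Rightarrow> 'u set" where
  "C_eq M \<sigma> = {x \<in> carr M (sty_of \<sigma>).
     \<exists>a\<in>tuples M (tpos \<sigma>). \<forall>b\<in>tuples M (tneg \<sigma>). interp M \<sigma> x a b}"

text \<open>
  The finite types for which \<open>C_eq\<close> only refers to carriers that are present in \<open>M\<close>.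
\<close>

definition covered :: "'u type_structure \<Rightarrow> fty set" where
  "covered M = {\<sigma>. sty_of \<sigma> \<in> types M \<and> set (tpos \<sigma>) \<subseteq> types M \<and> set (tneg \<sigma>) \<subseteq> types M}"

lemma covered_UNIV: "types M = UNIV \<Longrightarrow> covered M = UNIV"
  by (simp add: covered_def)

text \<open>
  \<open>C\<close>, as a family indexed by the finite types in \<open>E\<close>, is a model of Goedel's T.  The equations
  are required for all arguments in the full structure, so that (carriers being extensional)
  they determine each combinator and recursor uniquely as a set-theoretic function.
\<close>

definition model_of_T :: "'u type_structure \<Rightarrow> fty set \<Rightarrow> (fty \<Rightarrow> 'u set) \<Rightarrow> bool" where
  "model_of_T M E C \<longleftrightarrow>
     (\<forall>\<sigma>\<in>E. C \<sigma> \<subseteq> carr M (sty_of \<sigma>)) \<and>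
     C NatT = carr M NatS \<and>
     (\<forall>\<rho> \<sigma>. \<rho> \<rightarrow>\<^sub>f \<sigma> \<in> E \<longrightarrow> (\<forall>h\<in>C (\<rho> \<rightarrow>\<^sub>f \<sigma>). \<forall>x\<in>C \<rho>. appl M h x \<in> C \<sigma>)) \<and>
     (\<forall>\<rho> \<sigma>. arithmetical \<rho> \<and> arithmetical \<sigma> \<and> \<rho> \<rightarrow>\<^sub>f \<sigma> \<rightarrow>\<^sub>f \<rho> \<in> E \<longrightarrow>
        (\<exists>k\<in>C (\<rho> \<rightarrow>\<^sub>f \<sigma> \<rightarrow>\<^sub>f \<rho>).
           \<forall>x\<in>carr M (sty_of \<rho>). \<forall>y\<in>carr M (sty_of \<sigma>). appl M (appl M k x) y = x)) \<and>
     (\<forall>\<rho> \<sigma> \<tau>. arithmetical \<rho> \<and> arithmetical \<sigma> \<and> arithmetical \<tau> \<and>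
          (\<rho> \<rightarrow>\<^sub>f \<sigma> \<rightarrow>\<^sub>f \<tau>) \<rightarrow>\<^sub>f (\<rho> \<rightarrow>\<^sub>f \<sigma>) \<rightarrow>\<^sub>f \<rho> \<rightarrow>\<^sub>f \<tau> \<in> E \<longrightarrow>
        (\<exists>s\<in>C ((\<rho> \<rightarrow>\<^sub>f \<sigma> \<rightarrow>\<^sub>f \<tau>) \<rightarrow>\<^sub>f (\<rho> \<rightarrow>\<^sub>f \<sigma>) \<rightarrow>\<^sub>f \<rho> \<rightarrow>\<^sub>f \<tau>).
           \<forall>x\<in>carr M (sty_of (\<rho> \<rightarrow>\<^sub>f \<sigma> \<rightarrow>\<^sub>f \<tau>)). \<forall>y\<in>carr M (sty_of (\<rho> \<rightarrow>\<^sub>f \<sigma>)).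
           \<forall>z\<in>carr M (sty_of \<rho>).
             appl M (appl M (appl M s x) y) z = appl M (appl M x z) (appl M y z))) \<and>
     num_val M 0 \<in> C NatT \<and>
     (NatT \<rightarrow>\<^sub>f NatT \<in> E \<longrightarrow>
        (\<exists>s\<in>C (NatT \<rightarrow>\<^sub>f NatT). \<forall>n. appl M s (num_val M n) = num_val M (Suc n))) \<and>
     (\<forall>\<sigma>. arithmetical \<sigma> \<and> NatT \<rightarrow>\<^sub>f \<sigma> \<rightarrow>\<^sub>f (NatT \<rightarrow>\<^sub>f \<sigma> \<rightarrow>\<^sub>f \<sigma>) \<rightarrow>\<^sub>f \<sigma> \<in> E \<longrightarrow>
        (\<exists>r\<in>C (NatT \<rightarrow>\<^sub>f \<sigma> \<rightarrow>\<^sub>f (NatT \<rightarrow>\<^sub>f \<sigma> \<rightarrow>\<^sub>f \<sigma>) \<rightarrow>\<^sub>f \<sigma>).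
           \<forall>w\<in>carr M (sty_of \<sigma>). \<forall>f\<in>carr M (sty_of (NatT \<rightarrow>\<^sub>f \<sigma> \<rightarrow>\<^sub>f \<sigma>)).
             appl M (appl M (appl M r (num_val M 0)) w) f = w \<and>
             (\<forall>n. appl M (appl M (appl M r (num_val M (Suc n))) w) f =
                  appl M (appl M f (num_val M n))
                    (appl M (appl M (appl M r (num_val M n)) w) f))))"

text \<open>
  The remaining lemmas show that \<open>full_structure\<close> is satisfiable with the ground types, and
  that any missing type can be added when its immediate subtypes are present.
\<close>

lemma full_structureI:
  fixes M :: "'u type_structure"
  assumes "NatS \<in> types M" "BoolS \<in> types M"
    and "\<And>\<alpha> \<beta>. \<alpha> \<rightarrow>\<^sub>s \<beta> \<in> types M \<Longrightarrow> \<alpha> \<in> types M \<and> \<beta> \<in> types M"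
    and "\<And>\<alpha>. Star \<alpha> \<in> types M \<Longrightarrow> \<alpha> \<in> types M"
    and "bij_betw (num_val M) UNIV (carr M NatS)" "bij_betw (bool_val M) UNIV (carr M BoolS)"
    and "\<And>\<alpha> \<beta>. \<alpha> \<rightarrow>\<^sub>s \<beta> \<in> types M \<Longrightarrow>
      bij_betw (\<lambda>h. restrict (appl M h) (carr M \<alpha>)) (carr M (\<alpha> \<rightarrow>\<^sub>s \<beta>)) (carr M \<alpha> \<rightarrow>\<^sub>E carr M \<beta>)"
    and "\<And>\<alpha>. Star \<alpha> \<in> types M \<Longrightarrow>
      bij_betw (elts M) (carr M (Star \<alpha>)) {A. A \<subseteq> carr M \<alpha> \<and> finite A \<and> A \<noteq> {}}"
  shows "full_structure M"
proof -
  have a: "\<forall>\<alpha> \<beta>. \<alpha> \<rightarrow>\<^sub>s \<beta> \<in> types M \<longrightarrow> \<alpha> \<in> types M \<and> \<beta> \<in> types M"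
    by (intro allI impI; rule assms(3); assumption)
  have b: "\<forall>\<alpha>. Star \<alpha> \<in> types M \<longrightarrow> \<alpha> \<in> types M"
    by (intro allI impI; rule assms(4); assumption)
  have c: "\<forall>\<alpha> \<beta>. \<alpha> \<rightarrow>\<^sub>s \<beta> \<in> types M \<longrightarrow>
      bij_betw (\<lambda>h. restrict (appl M h) (carr M \<alpha>)) (carr M (\<alpha> \<rightarrow>\<^sub>s \<beta>)) (carr M \<alpha> \<rightarrow>\<^sub>E carr M \<beta>)"
    by (intro allI impI; rule assms(7); assumption)
  have d: "\<forall>\<alpha>. Star \<alpha> \<in> types M \<longrightarrow>
      bij_betw (elts M) (carr M (Star \<alpha>)) {A. A \<subseteq> carr M \<alpha> \<and> finite A \<and> A \<noteq> {}}"
    by (intro allI impI; rule assms(8); assumption)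
  show ?thesis
    unfolding full_structure_def
    by (rule conjI[OF assms(1) conjI[OF assms(2) conjI[OF a conjI[OF b
          conjI[OF assms(5) conjI[OF assms(6) conjI[OF c d]]]]]]])
qed

lemma full_structure_base:
  "\<exists>M :: (nat + bool) type_structure. full_structure M \<and> types M = {NatS, BoolS}"
proof (intro exI conjI)
  let ?M = "\<lparr>types = {NatS, BoolS},
      carr = (\<lambda>\<tau>. if \<tau> = NatS then range Inl else range Inr),
      appl = (\<lambda>h x. h), elts = (\<lambda>x. {}), num_val = Inl, bool_val = Inr\<rparr> :: (nat + bool) type_structure"
  show "full_structure ?M"
    by (auto simp: full_structure_def bij_betw_def inj_on_def)
  show "types ?M = {NatS, BoolS}" by simp
qed

lemma bij_betw_fun_transport:
  assumes bij: "bij_betw (\<lambda>h. restrict (ap h) A) C (A \<rightarrow>\<^sub>E B)" and "inj e"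
    and ap': "\<And>h x. ap' (e h) (Inl x) = Inl (ap h x)"
  shows "bij_betw (\<lambda>h. restrict (ap' h) (Inl ` A)) (e ` C) (Inl ` A \<rightarrow>\<^sub>E Inl ` B)"
proof (rule bij_betw_imageI)
  show "inj_on (\<lambda>h. restrict (ap' h) (Inl ` A)) (e ` C)"
  proof (rule inj_onI, clarsimp)
    fix h k assume hk: "h \<in> C" "k \<in> C"
      and eq: "restrict (ap' (e h)) (Inl ` A) = restrict (ap' (e k)) (Inl ` A)"
    have "ap h x = ap k x" if "x \<in> A" for x
      using fun_cong[OF eq, of "Inl x"] that by (simp add: ap')
    then have "restrict (ap h) A = restrict (ap k) A" by auto
    then show "e h = e k" using bij hk by (auto simp: bij_betw_def inj_on_def)
  qed
  have "k \<in> (\<lambda>h. restrict (ap' h) (Inl ` A)) ` e ` C" if k: "k \<in> Inl ` A \<rightarrow>\<^sub>E Inl ` B" for k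
  proof -
    have kv: "k (Inl x) \<in> Inl ` B" if "x \<in> A" for x using k that by auto
    have "restrict (\<lambda>x. projl (k (Inl x))) A \<in> A \<rightarrow>\<^sub>E B" using kv by fastforce
    then obtain h where h: "h \<in> C" "restrict (ap h) A = restrict (\<lambda>x. projl (k (Inl x))) A"
      using bij_betw_imp_surj_on[OF bij] by (metis (no_types, lifting) imageE)
    have "restrict (ap' (e h)) (Inl ` A) y = k y" for y
    proof (cases "y \<in> Inl ` A")
      case True
      then obtain x where x: "x \<in> A" "y = Inl x" by auto
      have "ap h x = projl (k (Inl x))" using fun_cong[OF h(2), of x] x by simp
      then show ?thesis using kv[of x] x by (auto simp: ap')
    next
      case False
      then show ?thesis using k by (auto simp: PiE_def extensional_def)
    qed
    then have "restrict (ap' (e h)) (Inl ` A) = k" by (rule ext)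
    then show ?thesis using h(1) by blast
  qed
  moreover have "restrict (ap' (e h)) (Inl ` A) \<in> Inl ` A \<rightarrow>\<^sub>E Inl ` B" if "h \<in> C" for h
  proof -
    have "restrict (ap h) A \<in> A \<rightarrow>\<^sub>E B" using bij_betw_apply[OF bij that] .
    then have "ap h x \<in> B" if "x \<in> A" for x using that by (auto dest!: PiE_mem[of _ _ _ x])
    then show ?thesis by (auto simp: ap' PiE_iff)
  qed
  ultimately show "(\<lambda>h. restrict (ap' h) (Inl ` A)) ` e ` C = Inl ` A \<rightarrow>\<^sub>E Inl ` B"
    by blast
qed

lemma bij_betw_set_transport:
  assumes bij: "bij_betw el C {A. A \<subseteq> B \<and> finite A \<and> A \<noteq> {}}" and "inj e"
    and el': "\<And>x. el' (e x) = Inl ` el x"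
  shows "bij_betw el' (e ` C) {A. A \<subseteq> Inl ` B \<and> finite A \<and> A \<noteq> {}}"
proof (rule bij_betw_imageI)
  show "inj_on el' (e ` C)"
    using bij by (auto simp: inj_on_def bij_betw_def el' inj_image_eq_iff)
  have "A \<in> el' ` e ` C" if A: "A \<subseteq> Inl ` B" "finite A" "A \<noteq> {}" for A
  proof -
    obtain A' where A': "A' \<subseteq> B" "A = Inl ` A'" using A(1) by (auto simp: subset_image_iff)
    then have "A' \<in> el ` C" using A bij by (auto simp: bij_betw_def finite_image_iff)
    then show ?thesis using A' el' by (auto simp: image_iff)
  qed
  moreover have "el' (e x) \<subseteq> Inl ` B \<and> finite (el' (e x)) \<and> el' (e x) \<noteq> {}" if "x \<in> C" for x
    using bij that by (auto simp: bij_betw_def el')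
  ultimately show "el' ` e ` C = {A. A \<subseteq> Inl ` B \<and> finite A \<and> A \<noteq> {}}"
    by blast
qed

lemma full_structure_fun:
  fixes M :: "'u type_structure"
  assumes M: "full_structure M" and sub: "\<rho> \<in> types M" "\<sigma> \<in> types M"
    and new: "\<rho> \<rightarrow>\<^sub>s \<sigma> \<notin> types M"
  shows "\<exists>M' :: ('u + ('u \<Rightarrow> 'u)) type_structure.
           full_structure M' \<and> types M' = insert (\<rho> \<rightarrow>\<^sub>s \<sigma>) (types M)"
proof (intro exI conjI)
  let ?F = "carr M \<rho> \<rightarrow>\<^sub>E carr M \<sigma>"
  let ?ap = "\<lambda>h x. Inl (case h of Inl h \<Rightarrow> appl M h (projl x) | Inr f \<Rightarrow> f (projl x))"
  let ?M = "\<lparr>types = insert (\<rho> \<rightarrow>\<^sub>s \<sigma>) (types M),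
      carr = (\<lambda>\<tau>. if \<tau> = \<rho> \<rightarrow>\<^sub>s \<sigma> then Inr ` ?F else Inl ` carr M \<tau>),
      appl = ?ap, elts = (\<lambda>x. Inl ` elts M (projl x)),
      num_val = Inl \<circ> num_val M, bool_val = Inl \<circ> bool_val M\<rparr>
      :: ('u + ('u \<Rightarrow> 'u)) type_structure"
  show "types ?M = insert (\<rho> \<rightarrow>\<^sub>s \<sigma>) (types M)" by simp
  have closed: "\<alpha> \<rightarrow>\<^sub>s \<beta> \<in> types M \<Longrightarrow> \<alpha> \<in> types M \<and> \<beta> \<in> types M"
      "Star \<alpha> \<in> types M \<Longrightarrow> \<alpha> \<in> types M" for \<alpha> \<beta>
    using M unfolding full_structure_def by blast+
  have base: "NatS \<in> types M" "BoolS \<in> types M"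
    and nbM: "bij_betw (num_val M) UNIV (carr M NatS)" "bij_betw (bool_val M) UNIV (carr M BoolS)"
    using M unfolding full_structure_def by simp_all
  have old: "\<alpha> \<in> types M \<Longrightarrow> carr ?M \<alpha> = Inl ` carr M \<alpha>" for \<alpha>
    using new by auto
  have fn: "bij_betw (\<lambda>h. restrict (appl ?M h) (carr ?M \<alpha>))
      (carr ?M (\<alpha> \<rightarrow>\<^sub>s \<beta>)) (carr ?M \<alpha> \<rightarrow>\<^sub>E carr ?M \<beta>)" if "\<alpha> \<rightarrow>\<^sub>s \<beta> \<in> types ?M" for \<alpha> \<beta>
  proof (cases "\<alpha> \<rightarrow>\<^sub>s \<beta> \<in> types M")
    case True
    then have b: "bij_betw (\<lambda>h. restrict (appl M h) (carr M \<alpha>))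
        (carr M (\<alpha> \<rightarrow>\<^sub>s \<beta>)) (carr M \<alpha> \<rightarrow>\<^sub>E carr M \<beta>)"
      using M unfolding full_structure_def by blast
    show ?thesis unfolding old[OF True] old[OF conjunct1[OF closed(1)[OF True]]]
        old[OF conjunct2[OF closed(1)[OF True]]]
      by (rule bij_betw_fun_transport[OF b]) simp_all
  next
    case False
    then have eq: "\<alpha> = \<rho>" "\<beta> = \<sigma>" using that by auto
    have "bij_betw (\<lambda>h. restrict h (carr M \<rho>)) ?F ?F"
      by (rule bij_betw_cong[THEN iffD2, OF _ bij_betw_id]) (auto simp: PiE_restrict)
    note b = bij_betw_fun_transport[OF this, of Inr ?ap]
    have c: "carr ?M (\<rho> \<rightarrow>\<^sub>s \<sigma>) = Inr ` ?F" by simp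
    show ?thesis unfolding eq old[OF sub(1)] old[OF sub(2)] c
      using b by simp
  qed
  have st: "bij_betw (elts ?M) (carr ?M (Star \<alpha>))
      {A. A \<subseteq> carr ?M \<alpha> \<and> finite A \<and> A \<noteq> {}}" if "Star \<alpha> \<in> types ?M" for \<alpha>
  proof -
    have t: "Star \<alpha> \<in> types M" using that by simp
    then have b: "bij_betw (elts M) (carr M (Star \<alpha>)) {A. A \<subseteq> carr M \<alpha> \<and> finite A \<and> A \<noteq> {}}"
      using M unfolding full_structure_def by blast
    show ?thesis unfolding old[OF t] old[OF closed(2)[OF t]]
      by (rule bij_betw_set_transport[OF b]) simp_all
  qed
  have nb: "bij_betw (num_val ?M) UNIV (carr ?M NatS)"
      "bij_betw (bool_val ?M) UNIV (carr ?M BoolS)"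
    using nbM by (auto simp: bij_betw_def inj_on_def)
  have fun_closed: "\<alpha> \<in> types ?M \<and> \<beta> \<in> types ?M" if "\<alpha> \<rightarrow>\<^sub>s \<beta> \<in> types ?M" for \<alpha> \<beta>
    using closed(1)[of \<alpha> \<beta>] sub that by auto
  have star_closed: "\<alpha> \<in> types ?M" if "Star \<alpha> \<in> types ?M" for \<alpha>
    using closed(2)[of \<alpha>] sub that by auto
  have base': "NatS \<in> types ?M" "BoolS \<in> types ?M"
    using base by simp_all
  show "full_structure ?M"
    by (rule full_structureI[OF base' fun_closed star_closed nb fn st])
qed

lemma full_structure_star:
  fixes M :: "'u type_structure"
  assumes M: "full_structure M" and sub: "\<sigma> \<in> types M" and new: "Star \<sigma> \<notin> types M"
  shows "\<exists>M' :: ('u + 'u set) type_structure.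
           full_structure M' \<and> types M' = insert (Star \<sigma>) (types M)"
proof (intro exI conjI)
  let ?P = "{A. A \<subseteq> carr M \<sigma> \<and> finite A \<and> A \<noteq> {}}"
  let ?el = "\<lambda>x. Inl ` (case x of Inl x \<Rightarrow> elts M x | Inr A \<Rightarrow> A)"
  let ?M = "\<lparr>types = insert (Star \<sigma>) (types M),
      carr = (\<lambda>\<tau>. if \<tau> = Star \<sigma> then Inr ` ?P else Inl ` carr M \<tau>),
      appl = (\<lambda>h x. Inl (appl M (projl h) (projl x))), elts = ?el,
      num_val = Inl \<circ> num_val M, bool_val = Inl \<circ> bool_val M\<rparr>
      :: ('u + 'u set) type_structure"
  show "types ?M = insert (Star \<sigma>) (types M)" by simp
  have closed: "\<alpha> \<rightarrow>\<^sub>s \<beta> \<in> types M \<Longrightarrow> \<alpha> \<in> types M \<and> \<beta> \<in> types M"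
      "Star \<alpha> \<in> types M \<Longrightarrow> \<alpha> \<in> types M" for \<alpha> \<beta>
    using M unfolding full_structure_def by blast+
  have base: "NatS \<in> types M" "BoolS \<in> types M"
    and nbM: "bij_betw (num_val M) UNIV (carr M NatS)" "bij_betw (bool_val M) UNIV (carr M BoolS)"
    using M unfolding full_structure_def by simp_all
  have old: "\<alpha> \<in> types M \<Longrightarrow> carr ?M \<alpha> = Inl ` carr M \<alpha>" for \<alpha>
    using new by auto
  have fn: "bij_betw (\<lambda>h. restrict (appl ?M h) (carr ?M \<alpha>))
      (carr ?M (\<alpha> \<rightarrow>\<^sub>s \<beta>)) (carr ?M \<alpha> \<rightarrow>\<^sub>E carr ?M \<beta>)" if "\<alpha> \<rightarrow>\<^sub>s \<beta> \<in> types ?M" for \<alpha> \<beta>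
  proof -
    have t: "\<alpha> \<rightarrow>\<^sub>s \<beta> \<in> types M" using that by simp
    then have b: "bij_betw (\<lambda>h. restrict (appl M h) (carr M \<alpha>))
        (carr M (\<alpha> \<rightarrow>\<^sub>s \<beta>)) (carr M \<alpha> \<rightarrow>\<^sub>E carr M \<beta>)"
      using M unfolding full_structure_def by blast
    show ?thesis unfolding old[OF t] old[OF conjunct1[OF closed(1)[OF t]]]
        old[OF conjunct2[OF closed(1)[OF t]]]
      by (rule bij_betw_fun_transport[OF b]) simp_all
  qed
  have st: "bij_betw (elts ?M) (carr ?M (Star \<alpha>))
      {A. A \<subseteq> carr ?M \<alpha> \<and> finite A \<and> A \<noteq> {}}" if "Star \<alpha> \<in> types ?M" for \<alpha>
  proof (cases "Star \<alpha> \<in> types M")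
    case True
    then have b: "bij_betw (elts M) (carr M (Star \<alpha>)) {A. A \<subseteq> carr M \<alpha> \<and> finite A \<and> A \<noteq> {}}"
      using M unfolding full_structure_def by blast
    show ?thesis unfolding old[OF True] old[OF closed(2)[OF True]]
      by (rule bij_betw_set_transport[OF b]) simp_all
  next
    case False
    then have eq: "\<alpha> = \<sigma>" using that by auto
    have "bij_betw (\<lambda>A. A) ?P ?P" by (simp add: bij_betw_def)
    note b = bij_betw_set_transport[OF this, of Inr ?el]
    have c: "carr ?M (Star \<sigma>) = Inr ` ?P" by simp
    show ?thesis unfolding eq old[OF sub] c using b by simp
  qed
  have nb: "bij_betw (num_val ?M) UNIV (carr ?M NatS)"
      "bij_betw (bool_val ?M) UNIV (carr ?M BoolS)"
    using nbM by (auto simp: bij_betw_def inj_on_def)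
  have fun_closed: "\<alpha> \<in> types ?M \<and> \<beta> \<in> types ?M" if "\<alpha> \<rightarrow>\<^sub>s \<beta> \<in> types ?M" for \<alpha> \<beta>
    using closed(1)[of \<alpha> \<beta>] sub that by auto
  have star_closed: "\<alpha> \<in> types ?M" if "Star \<alpha> \<in> types ?M" for \<alpha>
    using closed(2)[of \<alpha>] sub that by auto
  have base': "NatS \<in> types ?M" "BoolS \<in> types ?M"
    using base by simp_all
  show "full_structure ?M"
    by (rule full_structureI[OF base' fun_closed star_closed nb fn st])
qed

end

theory Submission
  imports Defs
begin

text \<open>
  A realiser of \<open>h : \<rho> \<rightarrow> \<sigma>\<close> amounts to a function \<open>F\<close> on upper tuples together with an arbitrary
  finite set \<open>G a d\<close> of lower tuples: since the relation is monotone in the sets bounding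
  \<open>b\<close>, a finite set of tuples may be replaced by a box that contains it.  Hence realisers of the
  combinators are obtained by reading off which finitely many instances of the premises a
  Diller--Nahm style argument uses.  For the recursor, each \<open>R n\<close> has a realiser by
  induction on \<open>n\<close>, and choosing one for each \<open>n\<close> realises \<open>R\<close>, because at type \<open>\<nat>\<close>
  the upper tuple is the number itself and the lower tuple is empty.  All realisers are
  constructed directly rather than by composing combinators, as the latter would pass
  through types whose carriers may be missing.
\<close>

section \<open>Tuples, boxes of tuples and the function clause\<close>

lemma in_listset_iff: "xs \<in> listset As \<longleftrightarrow> list_all2 (\<in>) xs As"
  by (induction As arbitrary: xs) (auto simp: set_Cons_def list_all2_Cons2)

lemma finite_listset: "(\<And>A. A \<in> set As \<Longrightarrow> finite A) \<Longrightarrow> finite (listset As)"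
proof (induction As)
  case (Cons A As)
  have "set_Cons A (listset As) = (\<lambda>(x, xs). x # xs) ` (A \<times> listset As)"
    by (auto simp: set_Cons_def)
  with Cons show ?case by simp
qed simp

lemma in_tuples_iff: "xs \<in> tuples M \<tau>s \<longleftrightarrow> list_all2 (\<lambda>x \<tau>. x \<in> carr M \<tau>) xs \<tau>s"
  by (simp add: tuples_def in_listset_iff list_all2_map2)

lemma tuples_Nil [simp]: "tuples M [] = {[]}"
  by (simp add: tuples_def)

lemma length_tuples: "xs \<in> tuples M \<tau>s \<Longrightarrow> length xs = length \<tau>s"
  by (auto simp: in_tuples_iff dest: list_all2_lengthD)

lemma tuples_append:
  "tuples M (\<tau>s @ \<tau>s') = {xs @ ys |xs ys. xs \<in> tuples M \<tau>s \<and> ys \<in> tuples M \<tau>s'}"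
  by (auto simp: in_tuples_iff list_all2_append2)
    (blast dest: list_all2_lengthD intro: list_all2_appendI)+

lemma append_in_tuples [intro]:
  "xs \<in> tuples M \<tau>s \<Longrightarrow> ys \<in> tuples M \<tau>s' \<Longrightarrow> xs @ ys \<in> tuples M (\<tau>s @ \<tau>s')"
  by (auto simp: tuples_append)

lemma take_drop_tuples:
  "xs \<in> tuples M \<tau>s \<Longrightarrow> take (length \<tau>s) (xs @ ys) = xs"
  "xs \<in> tuples M \<tau>s \<Longrightarrow> drop (length \<tau>s) (xs @ ys) = ys"
  by (simp_all add: length_tuples)

text \<open>With \<open>as\<close> split into f and g as in the function clause, \<open>pos\<close>
  is the upper tuple f a, and \<open>neg\<close> below is the box g a d, the product of the finite
  sets coded by its components. Where f ends depends on \<open>\<sigma>\<close> alone. If g is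
  empty, the box is \<open>{[]}\<close> and not the empty set.\<close>

definition pos :: "'u type_structure \<Rightarrow> fty \<Rightarrow> 'u list \<Rightarrow> 'u list \<Rightarrow> 'u list" where
  "pos M \<sigma> as a = map (\<lambda>f. appls M f a) (take (length (tpos \<sigma>)) as)"

definition neg :: "'u type_structure \<Rightarrow> fty \<Rightarrow> 'u list \<Rightarrow> 'u list \<Rightarrow> 'u list \<Rightarrow> 'u list set" where
  "neg M \<sigma> as a d = listset (map (\<lambda>g. elts M (appls M g (a @ d))) (drop (length (tpos \<sigma>)) as))"

text \<open>Lower tuples are handled as concatenations \<open>a @ d\<close> from here on, which
  turns the splitting in the recursive clause into a side condition on \<open>a\<close>. The clause
  itself then leaves the simp set.\<close>

lemma interp_fun:
  assumes "a \<in> tuples M (tpos \<rho>)"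
  shows "interp M (\<rho> \<rightarrow>\<^sub>f \<sigma>) h as (a @ d) \<longleftrightarrow>
    (\<forall>x\<in>carr M (sty_of \<rho>). (\<forall>b\<in>neg M \<sigma> as a d. interp M \<rho> x a b) \<longrightarrow>
      interp M \<sigma> (appl M h x) (pos M \<sigma> as a) d)"
  by (simp add: Let_def pos_def neg_def length_tuples[OF assms])

declare interp.simps(3) [simp del]

section \<open>Coding of functions and finite sets in a full structure\<close>

locale full_type_structure =
  fixes M :: "'u type_structure"
  assumes full: "full_structure M"
begin

abbreviation "\<T> \<equiv> types M"

lemma types_fun: "\<rho> \<rightarrow>\<^sub>s \<sigma> \<in> \<T> \<Longrightarrow> \<rho> \<in> \<T> \<and> \<sigma> \<in> \<T>"
  and types_star: "Star \<sigma> \<in> \<T> \<Longrightarrow> \<sigma> \<in> \<T>"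
  and bij_num: "bij_betw (num_val M) UNIV (carr M NatS)"
  and bij_bool: "bij_betw (bool_val M) UNIV (carr M BoolS)"
  and bij_fun: "\<rho> \<rightarrow>\<^sub>s \<sigma> \<in> \<T> \<Longrightarrow> bij_betw (\<lambda>h. restrict (appl M h) (carr M \<rho>))
          (carr M (\<rho> \<rightarrow>\<^sub>s \<sigma>)) (carr M \<rho> \<rightarrow>\<^sub>E carr M \<sigma>)"
  and bij_star: "Star \<sigma> \<in> \<T> \<Longrightarrow>
        bij_betw (elts M) (carr M (Star \<sigma>)) {A. A \<subseteq> carr M \<sigma> \<and> finite A \<and> A \<noteq> {}}"
  using full unfolding full_structure_def by (elim conjE; iprover)+

lemma types_funs: "funs \<tau>s \<gamma> \<in> \<T> \<Longrightarrow> set \<tau>s \<subseteq> \<T> \<and> \<gamma> \<in> \<T>"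
  by (induction \<tau>s) (auto dest: types_fun)

lemma num_val_carr [simp]: "num_val M n \<in> carr M NatS"
  by (rule bij_betw_apply[OF bij_num UNIV_I])

lemma carr_NatS_cases: "x \<in> carr M NatS \<Longrightarrow> (\<And>n. x = num_val M n \<Longrightarrow> P) \<Longrightarrow> P"
  using bij_betw_imp_surj_on[OF bij_num] by blast

lemma num_val_eq [simp]: "num_val M m = num_val M n \<longleftrightarrow> m = n"
  using bij_betw_imp_inj_on[OF bij_num] by (rule inj_eq)

lemma appl_carr:
  assumes "\<rho> \<rightarrow>\<^sub>s \<sigma> \<in> \<T>" "h \<in> carr M (\<rho> \<rightarrow>\<^sub>s \<sigma>)" "x \<in> carr M \<rho>"
  shows "appl M h x \<in> carr M \<sigma>"
  using PiE_mem[OF bij_betw_apply[OF bij_fun[OF assms(1)] assms(2)] assms(3)] assms(3) by simp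

text \<open>Fullness enters here: surjectivity in \<open>bij_fun\<close> yields a code for any
  function between the two carriers, once \<open>restrict\<close> has made it extensional.\<close>

lemma ex_fun:
  assumes "\<rho> \<rightarrow>\<^sub>s \<sigma> \<in> \<T>" "\<And>x. x \<in> carr M \<rho> \<Longrightarrow> h x \<in> carr M \<sigma>"
  shows "\<exists>k\<in>carr M (\<rho> \<rightarrow>\<^sub>s \<sigma>). \<forall>x\<in>carr M \<rho>. appl M k x = h x"
proof -
  have "restrict h (carr M \<rho>) \<in> carr M \<rho> \<rightarrow>\<^sub>E carr M \<sigma>" using assms(2) by simp
  then obtain k where k: "k \<in> carr M (\<rho> \<rightarrow>\<^sub>s \<sigma>)"
      "restrict (appl M k) (carr M \<rho>) = restrict h (carr M \<rho>)"
    using bij_betw_imp_surj_on[OF bij_fun[OF assms(1)]] by (metis (no_types, lifting) imageE)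
  have "appl M k x = h x" if "x \<in> carr M \<rho>" for x
    using that fun_cong[OF k(2), of x] by simp
  with k(1) show ?thesis by blast
qed

text \<open>Serves to write down the constants of T as nested abstractions; realisers come from
  \<open>ex_realiser\<close> instead.\<close>

definition lam :: "sty \<Rightarrow> sty \<Rightarrow> ('u \<Rightarrow> 'u) \<Rightarrow> 'u" where
  "lam \<rho> \<sigma> h = (SOME k. k \<in> carr M (\<rho> \<rightarrow>\<^sub>s \<sigma>) \<and> (\<forall>x\<in>carr M \<rho>. appl M k x = h x))"

lemma
  assumes "\<rho> \<rightarrow>\<^sub>s \<sigma> \<in> \<T>" "\<And>x. x \<in> carr M \<rho> \<Longrightarrow> h x \<in> carr M \<sigma>"
  shows lam_carr: "lam \<rho> \<sigma> h \<in> carr M (\<rho> \<rightarrow>\<^sub>s \<sigma>)"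
    and appl_lam: "x \<in> carr M \<rho> \<Longrightarrow> appl M (lam \<rho> \<sigma> h) x = h x"
proof -
  have "\<exists>k. k \<in> carr M (\<rho> \<rightarrow>\<^sub>s \<sigma>) \<and> (\<forall>x\<in>carr M \<rho>. appl M k x = h x)"
    using ex_fun[of \<rho> \<sigma> h, OF assms] by blast
  from someI_ex[OF this] show "lam \<rho> \<sigma> h \<in> carr M (\<rho> \<rightarrow>\<^sub>s \<sigma>)"
    and "x \<in> carr M \<rho> \<Longrightarrow> appl M (lam \<rho> \<sigma> h) x = h x"
    by (simp_all add: lam_def)
qed

lemma elts_carr:
  assumes "Star \<sigma> \<in> \<T>" "x \<in> carr M (Star \<sigma>)"
  shows "elts M x \<subseteq> carr M \<sigma>" "finite (elts M x)"
  using bij_betw_apply[OF bij_star[OF assms(1)] assms(2)] by simp_all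

lemma ex_star:
  assumes "Star \<sigma> \<in> \<T>" "A \<subseteq> carr M \<sigma>" "finite A" "A \<noteq> {}"
  shows "\<exists>x\<in>carr M (Star \<sigma>). elts M x = A"
proof -
  have "A \<in> elts M ` carr M (Star \<sigma>)"
    unfolding bij_betw_imp_surj_on[OF bij_star[OF assms(1)]] using assms(2-4) by simp
  then show ?thesis by blast
qed

text \<open>Elements of star type code non-empty sets, so \<open>ex_realiser\<close> has to put a
  default element into each of them. Constant functions and singletons are the inhabitants at
  compound types.\<close>

lemma carr_nonempty: "\<tau> \<in> \<T> \<Longrightarrow> carr M \<tau> \<noteq> {}"
proof (induction \<tau>)
  case NatS
  then show ?case using num_val_carr by blast
next
  case BoolS
  show ?case using bij_betw_apply[OF bij_bool UNIV_I] by blast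
next
  case (FunS \<rho> \<sigma>)
  then obtain y where "y \<in> carr M \<sigma>" using types_fun by blast
  with ex_fun[OF FunS.prems, of "\<lambda>_. y"] show ?case by blast
next
  case (Star \<sigma>)
  then obtain y where "y \<in> carr M \<sigma>" using types_star by blast
  with ex_star[OF Star.prems, of "{y}"] show ?case by blast
qed

lemma appls_carr:
  "funs \<tau>s \<gamma> \<in> \<T> \<Longrightarrow> h \<in> carr M (funs \<tau>s \<gamma>) \<Longrightarrow> as \<in> tuples M \<tau>s \<Longrightarrow> appls M h as \<in> carr M \<gamma>"
proof (induction \<tau>s arbitrary: h as)
  case (Cons \<tau> \<tau>s)
  then obtain x xs where as: "as = x # xs" "x \<in> carr M \<tau>" "xs \<in> tuples M \<tau>s"
    by (auto simp: in_tuples_iff list_all2_Cons2)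
  with Cons.prems have "appl M h x \<in> carr M (funs \<tau>s \<gamma>)" by (auto intro: appl_carr)
  with Cons as show ?case by (auto dest: types_fun)
qed simp

text \<open>Functions of a tuple are curried: for each first component the induction hypothesis
  codes the function of the remaining ones, and \<open>ex_fun\<close> codes the map that sends the
  component to that code.\<close>

lemma ex_funs:
  assumes "funs \<tau>s \<gamma> \<in> \<T>" "\<And>as. as \<in> tuples M \<tau>s \<Longrightarrow> h as \<in> carr M \<gamma>"
  shows "\<exists>k\<in>carr M (funs \<tau>s \<gamma>). \<forall>as\<in>tuples M \<tau>s. appls M k as = h as"
  using assms
proof (induction \<tau>s arbitrary: h)
  case (Cons \<tau> \<tau>s)
  have t: "\<tau> \<rightarrow>\<^sub>s funs \<tau>s \<gamma> \<in> \<T>" using Cons.prems by simp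
  have "\<exists>k\<in>carr M (funs \<tau>s \<gamma>). \<forall>xs\<in>tuples M \<tau>s. appls M k xs = h (x # xs)"
    if "x \<in> carr M \<tau>" for x
    using that types_fun[OF t] Cons.prems(2) by (intro Cons.IH) (auto simp: in_tuples_iff)
  then obtain k where k: "\<And>x. x \<in> carr M \<tau> \<Longrightarrow> k x \<in> carr M (funs \<tau>s \<gamma>)"
      "\<And>x xs. x \<in> carr M \<tau> \<Longrightarrow> xs \<in> tuples M \<tau>s \<Longrightarrow> appls M (k x) xs = h (x # xs)"
    by metis
  obtain k' where k': "k' \<in> carr M (\<tau> \<rightarrow>\<^sub>s funs \<tau>s \<gamma>)"
      "\<And>x. x \<in> carr M \<tau> \<Longrightarrow> appl M k' x = k x"
    using ex_fun[of \<tau> "funs \<tau>s \<gamma>" k, OF t k(1)] by blast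
  have "appls M k' as = h as" if "as \<in> tuples M (\<tau> # \<tau>s)" for as
    using that k(2) k'(2) by (auto simp: in_tuples_iff list_all2_Cons2)
  with k'(1) show ?case by auto
qed simp

text \<open>The lower tuple of a function type contains the upper tuple of the argument type and the
  lower tuple of the value type. The other two tuples occur as result types in its upper tuple, so
  closure of \<open>\<T>\<close> under subtypes reaches them.\<close>

lemma covered_fun:
  assumes "\<rho> \<rightarrow>\<^sub>f \<sigma> \<in> covered M"
  shows "\<rho> \<in> covered M" "\<sigma> \<in> covered M" "sty_of \<rho> \<rightarrow>\<^sub>s sty_of \<sigma> \<in> \<T>"
    "\<And>\<tau>. \<tau> \<in> set (tpos \<sigma>) \<Longrightarrow> funs (tpos \<rho>) \<tau> \<in> \<T>"
    "\<And>\<beta>. \<beta> \<in> set (tneg \<rho>) \<Longrightarrow> funs (tpos \<rho> @ tneg \<sigma>) (Star \<beta>) \<in> \<T>"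
proof -
  show 3: "sty_of \<rho> \<rightarrow>\<^sub>s sty_of \<sigma> \<in> \<T>" using assms by (simp add: covered_def)
  show 4: "funs (tpos \<rho>) \<tau> \<in> \<T>" if "\<tau> \<in> set (tpos \<sigma>)" for \<tau>
    using assms that by (auto simp: covered_def)
  show 5: "funs (tpos \<rho> @ tneg \<sigma>) (Star \<beta>) \<in> \<T>" if "\<beta> \<in> set (tneg \<rho>)" for \<beta>
    using assms that by (auto simp: covered_def)
  show "\<rho> \<in> covered M" "\<sigma> \<in> covered M"
    using assms types_fun[OF 3] types_funs[OF 4] types_funs[OF 5]
    by (auto simp: covered_def dest: types_star)
qed

section \<open>Realisers at function types\<close>

lemma pos_tuples:
  assumes "\<rho> \<rightarrow>\<^sub>f \<sigma> \<in> covered M" "as \<in> tuples M (tpos (\<rho> \<rightarrow>\<^sub>f \<sigma>))" "a \<in> tuples M (tpos \<rho>)"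
  shows "pos M \<sigma> as a \<in> tuples M (tpos \<sigma>)"
proof -
  obtain f g where f: "as = f @ g" "f \<in> tuples M (map (funs (tpos \<rho>)) (tpos \<sigma>))"
    using assms(2) by (auto simp: tuples_append)
  have "length f = length (tpos \<sigma>)" using length_tuples[OF f(2)] by simp
  moreover have "map (\<lambda>f. appls M f a) f \<in> tuples M (tpos \<sigma>)"
    using f(2) covered_fun(4)[OF assms(1)] assms(3)
    by (auto simp: in_tuples_iff list_all2_map1 list_all2_map2 list_all2_conv_all_nth
        intro!: appls_carr)
  ultimately show ?thesis using f(1) by (simp add: pos_def)
qed

text \<open>Each factor of the box is decoded from an object of star type, hence is a finite set of
  objects of the right type. Finiteness lets such boxes be merged into the sets \<open>G\<close>
  chosen for the combinators and the recursor.\<close>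

lemma
  assumes "\<rho> \<rightarrow>\<^sub>f \<sigma> \<in> covered M" "as \<in> tuples M (tpos (\<rho> \<rightarrow>\<^sub>f \<sigma>))"
    "a \<in> tuples M (tpos \<rho>)" "d \<in> tuples M (tneg \<sigma>)"
  shows neg_tuples: "neg M \<sigma> as a d \<subseteq> tuples M (tneg \<rho>)"
    and finite_neg: "finite (neg M \<sigma> as a d)"
proof -
  obtain f g where f: "as = f @ g" "f \<in> tuples M (map (funs (tpos \<rho>)) (tpos \<sigma>))"
    and g: "g \<in> tuples M (map (\<lambda>\<beta>. funs (tpos \<rho> @ tneg \<sigma>) (Star \<beta>)) (tneg \<rho>))"
    using assms(2) by (auto simp: tuples_append)
  have "length f = length (tpos \<sigma>)" using length_tuples[OF f(2)] by simp
  then have eq: "neg M \<sigma> as a d = listset (map (\<lambda>g. elts M (appls M g (a @ d))) g)"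
    using f(1) by (simp add: neg_def)
  have "a @ d \<in> tuples M (tpos \<rho> @ tneg \<sigma>)" using assms by blast
  then have star: "appls M (g ! i) (a @ d) \<in> carr M (Star (tneg \<rho> ! i))"
      and t: "Star (tneg \<rho> ! i) \<in> \<T>" if "i < length (tneg \<rho>)" for i
    using g that covered_fun(5)[OF assms(1), of "tneg \<rho> ! i"]
      appls_carr[of "tpos \<rho> @ tneg \<sigma>" "Star (tneg \<rho> ! i)" "g ! i" "a @ d"]
      types_funs[of "tpos \<rho> @ tneg \<sigma>" "Star (tneg \<rho> ! i)"]
    by (auto simp: in_tuples_iff list_all2_conv_all_nth)
  have len: "length g = length (tneg \<rho>)" using length_tuples[OF g] by simp
  note * = elts_carr[OF t star]
  show "neg M \<sigma> as a d \<subseteq> tuples M (tneg \<rho>)"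
    unfolding eq using * len
    by (force simp: in_listset_iff in_tuples_iff list_all2_conv_all_nth)
  show "finite (neg M \<sigma> as a d)"
    unfolding eq using *(2) len by (intro finite_listset) (auto simp: in_set_conv_nth)
qed

text \<open>The components of f code the coordinates of \<open>F\<close>. The i-th component of g
  codes, at each \<open>a @ d\<close>, the set of i-th coordinates of \<open>G a d\<close>. The box
  of these projections contains \<open>G a d\<close> but may be larger, hence an inclusion in the
  conclusion and not an equation.\<close>

lemma ex_realiser:
  assumes cov: "\<rho> \<rightarrow>\<^sub>f \<sigma> \<in> covered M"
    and F: "\<And>a. a \<in> tuples M (tpos \<rho>) \<Longrightarrow> F a \<in> tuples M (tpos \<sigma>)"
    and G: "\<And>a d. a \<in> tuples M (tpos \<rho>) \<Longrightarrow> d \<in> tuples M (tneg \<sigma>) \<Longrightarrow>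
      finite (G a d) \<and> G a d \<subseteq> tuples M (tneg \<rho>)"
  shows "\<exists>as\<in>tuples M (tpos (\<rho> \<rightarrow>\<^sub>f \<sigma>)). \<forall>a\<in>tuples M (tpos \<rho>). pos M \<sigma> as a = F a \<and>
      (\<forall>d\<in>tuples M (tneg \<sigma>). G a d \<subseteq> neg M \<sigma> as a d)"
proof -
  let ?p = "length (tpos \<sigma>)" and ?n = "length (tneg \<rho>)" and ?r = "length (tpos \<rho>)"
  have "\<exists>k\<in>carr M (funs (tpos \<rho>) (tpos \<sigma> ! i)). \<forall>a\<in>tuples M (tpos \<rho>). appls M k a = F a ! i"
    if "i < ?p" for i
    using that F by (intro ex_funs covered_fun(4)[OF cov])
      (auto simp: in_tuples_iff list_all2_conv_all_nth)
  then obtain f where f: "\<And>i. i < ?p \<Longrightarrow> f i \<in> carr M (funs (tpos \<rho>) (tpos \<sigma> ! i))"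
      "\<And>i a. i < ?p \<Longrightarrow> a \<in> tuples M (tpos \<rho>) \<Longrightarrow> appls M (f i) a = F a ! i"
    by metis
  have "\<exists>k\<in>carr M (funs (tpos \<rho> @ tneg \<sigma>) (Star (tneg \<rho> ! i))).
      \<forall>a\<in>tuples M (tpos \<rho>). \<forall>d\<in>tuples M (tneg \<sigma>). (\<lambda>b. b ! i) ` G a d \<subseteq> elts M (appls M k (a @ d))"
    if i: "i < ?n" for i
  proof -
    let ?\<beta> = "tneg \<rho> ! i"
    have t: "funs (tpos \<rho> @ tneg \<sigma>) (Star ?\<beta>) \<in> \<T>" using i by (intro covered_fun(5)[OF cov]) simp
    then have s: "Star ?\<beta> \<in> \<T>" using types_funs by blast
    \<comment> \<open>\<open>G a d\<close> may be empty, as for the second argument of K, whereas a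
      code of star type stands for a non-empty set; \<open>z\<close> is the default element.\<close>
    obtain z where z: "z \<in> carr M ?\<beta>" using carr_nonempty types_star[OF s] by blast
    \<comment> \<open>The component to be coded is a function of one concatenated tuple, so the
      arguments of \<open>G\<close> are recovered from \<open>ad\<close> by cutting it after the
      length of \<open>tpos \<rho>\<close>.\<close>
    have "\<exists>x\<in>carr M (Star ?\<beta>). elts M x =
        insert z ((\<lambda>b. b ! i) ` G (take ?r ad) (drop ?r ad))"
      if adt: "ad \<in> tuples M (tpos \<rho> @ tneg \<sigma>)" for ad
    proof (rule ex_star[OF s])
      obtain a d where ad: "ad = a @ d" "a \<in> tuples M (tpos \<rho>)" "d \<in> tuples M (tneg \<sigma>)"
        using adt unfolding tuples_append by blast
      with G[OF ad(2,3)] length_tuples[OF ad(2)]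
      show "finite (insert z ((\<lambda>b. b ! i) ` G (take ?r ad) (drop ?r ad)))"
        by simp
      show "insert z ((\<lambda>b. b ! i) ` G (take ?r ad) (drop ?r ad)) \<subseteq> carr M ?\<beta>"
        using G[OF ad(2,3)] ad(1) length_tuples[OF ad(2)] z i
        by (auto simp: in_tuples_iff list_all2_conv_all_nth)
    qed simp
    then obtain S where S: "\<And>ad. ad \<in> tuples M (tpos \<rho> @ tneg \<sigma>) \<Longrightarrow> S ad \<in> carr M (Star ?\<beta>)"
        "\<And>ad. ad \<in> tuples M (tpos \<rho> @ tneg \<sigma>) \<Longrightarrow>
          elts M (S ad) = insert z ((\<lambda>b. b ! i) ` G (take ?r ad) (drop ?r ad))"
      by metis
    obtain k where k: "k \<in> carr M (funs (tpos \<rho> @ tneg \<sigma>) (Star ?\<beta>))"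
      "\<forall>ad\<in>tuples M (tpos \<rho> @ tneg \<sigma>). appls M k ad = S ad"
      using ex_funs[of "tpos \<rho> @ tneg \<sigma>" "Star ?\<beta>" S, OF t S(1)] by blast
    have "(\<lambda>b. b ! i) ` G a d \<subseteq> elts M (appls M k (a @ d))"
      if ad: "a \<in> tuples M (tpos \<rho>)" "d \<in> tuples M (tneg \<sigma>)" for a d
    proof -
      have ad': "a @ d \<in> tuples M (tpos \<rho> @ tneg \<sigma>)" using ad by blast
      have "elts M (appls M k (a @ d)) = insert z ((\<lambda>b. b ! i) ` G a d)"
        unfolding bspec[OF k(2) ad'] S(2)[OF ad'] take_drop_tuples[OF ad(1)] ..
      then show ?thesis by blast
    qed
    with k(1) show ?thesis by blast
  qed
  then obtain g where g: "\<And>i. i < ?n \<Longrightarrow> g i \<in> carr M (funs (tpos \<rho> @ tneg \<sigma>) (Star (tneg \<rho> ! i)))"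
      "\<And>i a d. i < ?n \<Longrightarrow> a \<in> tuples M (tpos \<rho>) \<Longrightarrow> d \<in> tuples M (tneg \<sigma>) \<Longrightarrow>
        (\<lambda>b. b ! i) ` G a d \<subseteq> elts M (appls M (g i) (a @ d))"
    by metis
  let ?as = "map f [0..<?p] @ map g [0..<?n]"
  have "map f [0..<?p] \<in> tuples M (map (funs (tpos \<rho>)) (tpos \<sigma>))"
    using f(1) by (simp add: in_tuples_iff list_all2_conv_all_nth)
  moreover have "map g [0..<?n] \<in> tuples M (map (\<lambda>\<beta>. funs (tpos \<rho> @ tneg \<sigma>) (Star \<beta>)) (tneg \<rho>))"
    using g(1) by (simp add: in_tuples_iff list_all2_conv_all_nth)
  ultimately have 1: "?as \<in> tuples M (tpos (\<rho> \<rightarrow>\<^sub>f \<sigma>))"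
    unfolding tpos.simps by (rule append_in_tuples)
  have 2: "pos M \<sigma> ?as a = F a" if "a \<in> tuples M (tpos \<rho>)" for a
    using f(2)[OF _ that] length_tuples[OF F[OF that]] by (auto simp: pos_def intro: nth_equalityI)
  have 3: "G a d \<subseteq> neg M \<sigma> ?as a d"
    if ad: "a \<in> tuples M (tpos \<rho>)" "d \<in> tuples M (tneg \<sigma>)" for a d
  proof
    fix b assume b: "b \<in> G a d"
    then have "length b = ?n" using G[OF ad] length_tuples by blast
    then show "b \<in> neg M \<sigma> ?as a d"
      using g(2)[OF _ ad] b by (auto simp: neg_def in_listset_iff list_all2_conv_all_nth)
  qed
  from 1 2 3 show ?thesis by blast
qed

text \<open>Depends on \<open>F\<close> and \<open>G\<close> only and not on the object to be
  realised. The nested constructions rely on this: the tuple that realises \<open>appl M k x\<close>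
  has to be a function of the upper tuple of \<open>x\<close>, the same for every \<open>x\<close>
  that passes the required tests.\<close>

definition mk :: "fty \<Rightarrow> fty \<Rightarrow> ('u list \<Rightarrow> 'u list) \<Rightarrow> ('u list \<Rightarrow> 'u list \<Rightarrow> 'u list set) \<Rightarrow> 'u list" where
  "mk \<rho> \<sigma> F G = (SOME as. as \<in> tuples M (tpos (\<rho> \<rightarrow>\<^sub>f \<sigma>)) \<and>
    (\<forall>a\<in>tuples M (tpos \<rho>). pos M \<sigma> as a = F a \<and>
      (\<forall>d\<in>tuples M (tneg \<sigma>). G a d \<subseteq> neg M \<sigma> as a d)))"

text \<open>In the function clause the premise on \<open>x\<close> ranges over the box
  \<open>neg\<close>, which contains \<open>G a d\<close>, so whatever follows from the instances in
  \<open>G a d\<close> follows from that premise. Realising a function is thereby reduced to naming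
  \<open>F\<close> and \<open>G\<close> and proving one implication.\<close>

lemma
  assumes cov: "\<rho> \<rightarrow>\<^sub>f \<sigma> \<in> covered M"
    and F: "\<And>a. a \<in> tuples M (tpos \<rho>) \<Longrightarrow> F a \<in> tuples M (tpos \<sigma>)"
    and G: "\<And>a d. a \<in> tuples M (tpos \<rho>) \<Longrightarrow> d \<in> tuples M (tneg \<sigma>) \<Longrightarrow>
      finite (G a d) \<and> G a d \<subseteq> tuples M (tneg \<rho>)"
  shows mk_tuples: "mk \<rho> \<sigma> F G \<in> tuples M (tpos (\<rho> \<rightarrow>\<^sub>f \<sigma>))"
    and interp_mk: "\<And>a d h. a \<in> tuples M (tpos \<rho>) \<Longrightarrow> d \<in> tuples M (tneg \<sigma>) \<Longrightarrow>
      (\<And>x. x \<in> carr M (sty_of \<rho>) \<Longrightarrow> \<forall>b\<in>G a d. interp M \<rho> x a b \<Longrightarrow>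
        interp M \<sigma> (appl M h x) (F a) d) \<Longrightarrow>
      interp M (\<rho> \<rightarrow>\<^sub>f \<sigma>) h (mk \<rho> \<sigma> F G) (a @ d)"
proof -
  have "\<exists>as. as \<in> tuples M (tpos (\<rho> \<rightarrow>\<^sub>f \<sigma>)) \<and>
    (\<forall>a\<in>tuples M (tpos \<rho>). pos M \<sigma> as a = F a \<and>
      (\<forall>d\<in>tuples M (tneg \<sigma>). G a d \<subseteq> neg M \<sigma> as a d))"
    using ex_realiser[OF cov, of F G, OF F G] by blast
  from someI_ex[OF this] have *: "mk \<rho> \<sigma> F G \<in> tuples M (tpos (\<rho> \<rightarrow>\<^sub>f \<sigma>))"
    "\<And>a. a \<in> tuples M (tpos \<rho>) \<Longrightarrow> pos M \<sigma> (mk \<rho> \<sigma> F G) a = F a"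
    "\<And>a d. a \<in> tuples M (tpos \<rho>) \<Longrightarrow> d \<in> tuples M (tneg \<sigma>) \<Longrightarrow> G a d \<subseteq> neg M \<sigma> (mk \<rho> \<sigma> F G) a d"
    unfolding mk_def by blast+
  show "mk \<rho> \<sigma> F G \<in> tuples M (tpos (\<rho> \<rightarrow>\<^sub>f \<sigma>))" by (rule *)
  fix a d h
  assume "a \<in> tuples M (tpos \<rho>)" "d \<in> tuples M (tneg \<sigma>)"
    "\<And>x. x \<in> carr M (sty_of \<rho>) \<Longrightarrow> \<forall>b\<in>G a d. interp M \<rho> x a b \<Longrightarrow>
      interp M \<sigma> (appl M h x) (F a) d"
  with * show "interp M (\<rho> \<rightarrow>\<^sub>f \<sigma>) h (mk \<rho> \<sigma> F G) (a @ d)"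
    by (simp add: interp_fun) blast
qed

section \<open>The type-structure \<open>C_eq\<close>: numbers, application, functions of a
  number\<close>

lemma C_eq_carr: "x \<in> C_eq M \<sigma> \<Longrightarrow> x \<in> carr M (sty_of \<sigma>)"
  by (simp add: C_eq_def)

lemma C_eq_NatT: "C_eq M NatT = carr M NatS"
  by (auto simp: C_eq_def in_tuples_iff)

text \<open>Modus ponens: the upper tuple \<open>a\<close> of \<open>x\<close> passes all tests, in
  particular those in the box demanded by the realiser \<open>as\<close> of \<open>h\<close>, so
  \<open>pos M \<sigma> as a\<close> realises the value.\<close>

lemma appl_C_eq:
  assumes "\<rho> \<rightarrow>\<^sub>f \<sigma> \<in> covered M" "h \<in> C_eq M (\<rho> \<rightarrow>\<^sub>f \<sigma>)" "x \<in> C_eq M \<rho>"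
  shows "appl M h x \<in> C_eq M \<sigma>"
proof -
  obtain as where as: "as \<in> tuples M (tpos (\<rho> \<rightarrow>\<^sub>f \<sigma>))"
      "\<And>b. b \<in> tuples M (tneg (\<rho> \<rightarrow>\<^sub>f \<sigma>)) \<Longrightarrow> interp M (\<rho> \<rightarrow>\<^sub>f \<sigma>) h as b"
    using assms(2) unfolding C_eq_def by blast
  obtain a where a: "a \<in> tuples M (tpos \<rho>)" "\<And>b. b \<in> tuples M (tneg \<rho>) \<Longrightarrow> interp M \<rho> x a b"
    using assms(3) unfolding C_eq_def by blast
  have "interp M \<sigma> (appl M h x) (pos M \<sigma> as a) d" if d: "d \<in> tuples M (tneg \<sigma>)" for d
  proof -
    have "interp M (\<rho> \<rightarrow>\<^sub>f \<sigma>) h as (a @ d)" using as(2) a(1) d by auto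
    then show ?thesis
      using interp_fun[OF a(1)] C_eq_carr[OF assms(3)] a(2)
        neg_tuples[OF assms(1) as(1) a(1) d] by blast
  qed
  moreover have "appl M h x \<in> carr M (sty_of \<sigma>)"
    using appl_carr[OF covered_fun(3)[OF assms(1)]] C_eq_carr[OF assms(2)] C_eq_carr[OF assms(3)]
    by simp
  ultimately show ?thesis
    using pos_tuples[OF assms(1) as(1) a(1)] unfolding C_eq_def by blast
qed

text \<open>The upper tuple of a number is the number itself, so a realiser of \<open>h\<close> may
  use a separately chosen realiser for each value; no uniformity in the argument is
  demanded.\<close>

lemma fun_NatT_C_eqI:
  assumes cov: "NatT \<rightarrow>\<^sub>f \<sigma> \<in> covered M" and h: "h \<in> carr M (NatS \<rightarrow>\<^sub>s sty_of \<sigma>)"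
    and C: "\<And>n. appl M h (num_val M n) \<in> C_eq M \<sigma>"
  shows "h \<in> C_eq M (NatT \<rightarrow>\<^sub>f \<sigma>)"
proof -
  have "\<exists>a\<in>tuples M (tpos \<sigma>). \<forall>b\<in>tuples M (tneg \<sigma>). interp M \<sigma> (appl M h x) a b"
    if "x \<in> carr M NatS" for x
    using that C by (auto simp: C_eq_def elim!: carr_NatS_cases)
  then obtain F where F: "\<And>x. x \<in> carr M NatS \<Longrightarrow> F x \<in> tuples M (tpos \<sigma>)"
    "\<And>x b. x \<in> carr M NatS \<Longrightarrow> b \<in> tuples M (tneg \<sigma>) \<Longrightarrow> interp M \<sigma> (appl M h x) (F x) b"
    by metis
  \<comment> \<open>The only lower tuple at \<open>NatT\<close> is \<open>[]\<close>. Demanding this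
    test makes the premise say \<open>a = [x]\<close>, so that \<open>hd a\<close> is the actual
    argument; with an empty set of tests nothing would link \<open>a\<close> to
    \<open>x\<close>.\<close>
  let ?as = "mk NatT \<sigma> (\<lambda>a. F (hd a)) (\<lambda>_ _. {[]})"
  have N: "hd a \<in> carr M NatS" if "a \<in> tuples M (tpos NatT)" for a
    using that by (auto simp: in_tuples_iff list_all2_Cons2)
  have F': "F (hd a) \<in> tuples M (tpos \<sigma>)" if "a \<in> tuples M (tpos NatT)" for a
    using F(1)[OF N[OF that]] .
  have G': "finite {[]} \<and> {[]} \<subseteq> tuples M (tneg NatT)"
    by simp
  have "?as \<in> tuples M (tpos (NatT \<rightarrow>\<^sub>f \<sigma>))"
    by (rule mk_tuples[OF cov F' G'])
  moreover have "interp M (NatT \<rightarrow>\<^sub>f \<sigma>) h ?as b" if "b \<in> tuples M (tneg (NatT \<rightarrow>\<^sub>f \<sigma>))" for b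
  proof -
    obtain a d where b: "b = a @ d" and a: "a \<in> tuples M (tpos NatT)" and d: "d \<in> tuples M (tneg \<sigma>)"
      using \<open>b \<in> _\<close> unfolding tneg.simps tuples_append by blast
    show ?thesis unfolding b
    proof (rule interp_mk[OF cov F' G' a d])
      fix x assume "x \<in> carr M (sty_of NatT)" "\<forall>b\<in>{[]}. interp M NatT x a b"
      then show "interp M \<sigma> (appl M h x) (F (hd a)) d" using F(2)[OF _ d] by simp
    qed
  qed
  ultimately show ?thesis using h unfolding C_eq_def by auto
qed

section \<open>Realisers for the combinators and for one recursion step\<close>

lemma C_eqI:
  assumes "x \<in> carr M (sty_of \<sigma>)" "a \<in> tuples M (tpos \<sigma>)"
    "\<And>b. b \<in> tuples M (tneg \<sigma>) \<Longrightarrow> interp M \<sigma> x a b"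
  shows "x \<in> C_eq M \<sigma>"
  using assms unfolding C_eq_def by blast

lemma tneg_funE:
  assumes "b \<in> tuples M (tneg (\<rho> \<rightarrow>\<^sub>f \<sigma>))"
  obtains a d where "b = a @ d" "a \<in> tuples M (tpos \<rho>)" "d \<in> tuples M (tneg \<sigma>)"
  using assms unfolding tneg.simps tuples_append by blast

lemma tneg_funI:
  "a \<in> tuples M (tpos \<rho>) \<Longrightarrow> d \<in> tuples M (tneg \<sigma>) \<Longrightarrow> a @ d \<in> tuples M (tneg (\<rho> \<rightarrow>\<^sub>f \<sigma>))"
  unfolding tneg.simps by (rule append_in_tuples)

text \<open>The elimination rule matching \<open>interp_mk\<close>. It assumes a single test
  \<open>a @ d\<close> on the function, so each use shows exactly which instances have to be
  collected in the bounding sets.\<close>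

lemma interp_appl:
  assumes "interp M (\<rho> \<rightarrow>\<^sub>f \<sigma>) h as (a @ d)" "a \<in> tuples M (tpos \<rho>)" "x \<in> carr M (sty_of \<rho>)"
    "\<And>b. b \<in> neg M \<sigma> as a d \<Longrightarrow> interp M \<rho> x a b"
  shows "interp M \<sigma> (appl M h x) (pos M \<sigma> as a) d"
  using assms(1,3,4) by (simp add: interp_fun[OF assms(2)])

text \<open>The result is x itself, so \<open>a\<close> is passed through as its upper tuple; a test
  \<open>d\<close> on the result is a test \<open>d\<close> on x, and y is not tested. As
  \<open>k\<close> is any object obeying the equation, the recursor at zero is covered too.\<close>

lemma K_C_eq:
  assumes cov: "\<rho> \<rightarrow>\<^sub>f \<sigma> \<rightarrow>\<^sub>f \<rho> \<in> covered M" and k: "k \<in> carr M (sty_of (\<rho> \<rightarrow>\<^sub>f \<sigma> \<rightarrow>\<^sub>f \<rho>))"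
    and eq: "\<And>x y. x \<in> carr M (sty_of \<rho>) \<Longrightarrow> y \<in> carr M (sty_of \<sigma>) \<Longrightarrow> appl M (appl M k x) y = x"
  shows "k \<in> C_eq M (\<rho> \<rightarrow>\<^sub>f \<sigma> \<rightarrow>\<^sub>f \<rho>)"
proof (rule C_eqI[OF k])
  have cov': "\<sigma> \<rightarrow>\<^sub>f \<rho> \<in> covered M" using covered_fun[OF cov] by blast
  define F where "F a = mk \<sigma> \<rho> (\<lambda>_. a) (\<lambda>_ _. {})" for a
  \<comment> \<open>\<open>bd\<close> is a lower tuple \<open>b @ d\<close> of the type of functions
    from \<open>\<sigma>\<close> to \<open>\<rho>\<close>; removing \<open>b\<close> leaves the test
    for x.\<close>
  define G where "G a bd = {drop (length (tpos \<sigma>)) bd}" for a bd :: "'u list"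
  have G_eq: "G a (b @ d) = {d}" if "b \<in> tuples M (tpos \<sigma>)" for a b d
    by (simp add: G_def length_tuples[OF that])
  have F: "F a \<in> tuples M (tpos (\<sigma> \<rightarrow>\<^sub>f \<rho>))" if "a \<in> tuples M (tpos \<rho>)" for a
    unfolding F_def using that by (intro mk_tuples[OF cov']) auto
  have F_interp: "interp M (\<sigma> \<rightarrow>\<^sub>f \<rho>) h (F a) (b @ d)"
    if "a \<in> tuples M (tpos \<rho>)" "b \<in> tuples M (tpos \<sigma>)" "d \<in> tuples M (tneg \<rho>)"
      "\<And>y. y \<in> carr M (sty_of \<sigma>) \<Longrightarrow> interp M \<rho> (appl M h y) a d" for h a b d
    unfolding F_def using that by (intro interp_mk[OF cov']) auto
  have G: "finite (G a bd) \<and> G a bd \<subseteq> tuples M (tneg \<rho>)"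
    if "bd \<in> tuples M (tneg (\<sigma> \<rightarrow>\<^sub>f \<rho>))" for a bd
    using that by (elim tneg_funE) (auto simp: G_eq)
  show "mk \<rho> (\<sigma> \<rightarrow>\<^sub>f \<rho>) F G \<in> tuples M (tpos (\<rho> \<rightarrow>\<^sub>f \<sigma> \<rightarrow>\<^sub>f \<rho>))"
    by (rule mk_tuples[OF cov F G])
  fix abd assume "abd \<in> tuples M (tneg (\<rho> \<rightarrow>\<^sub>f \<sigma> \<rightarrow>\<^sub>f \<rho>))"
  then obtain a b d where abd: "abd = a @ b @ d" and a: "a \<in> tuples M (tpos \<rho>)"
    and b: "b \<in> tuples M (tpos \<sigma>)" and d: "d \<in> tuples M (tneg \<rho>)"
    by (elim tneg_funE) blast
  show "interp M (\<rho> \<rightarrow>\<^sub>f \<sigma> \<rightarrow>\<^sub>f \<rho>) k (mk \<rho> (\<sigma> \<rightarrow>\<^sub>f \<rho>) F G) abd"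
    unfolding abd
  proof (rule interp_mk[OF cov F G a tneg_funI[OF b d]])
    fix x assume "x \<in> carr M (sty_of \<rho>)" "\<forall>d\<in>G a (b @ d). interp M \<rho> x a d"
    then show "interp M (\<sigma> \<rightarrow>\<^sub>f \<rho>) (appl M k x) (F a) (b @ d)"
      by (intro F_interp a b d) (simp add: eq G_eq[OF b])
  qed
qed

text \<open>Let \<open>a\<close>, \<open>c\<close>, \<open>e\<close> be upper tuples for x, y, z.
  Application gives \<open>v c e\<close> for y z, \<open>u a e\<close> for x z, and from these
  \<open>F\<^sub>3\<close> for the result. The bounding sets arise by going backwards from a test
  \<open>d\<close> on the result and collecting the instances of x, y and z that are used.\<close>

lemma S_C_eq:
  fixes \<rho> \<sigma> \<tau>
  defines "X \<equiv> \<rho> \<rightarrow>\<^sub>f \<sigma> \<rightarrow>\<^sub>f \<tau>" and "Y \<equiv> \<rho> \<rightarrow>\<^sub>f \<sigma>" and "Z \<equiv> \<rho> \<rightarrow>\<^sub>f \<tau>"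
  assumes cov: "X \<rightarrow>\<^sub>f Y \<rightarrow>\<^sub>f Z \<in> covered M" and s: "s \<in> carr M (sty_of (X \<rightarrow>\<^sub>f Y \<rightarrow>\<^sub>f Z))"
    and eq: "\<And>x y z. x \<in> carr M (sty_of X) \<Longrightarrow> y \<in> carr M (sty_of Y) \<Longrightarrow>
      z \<in> carr M (sty_of \<rho>) \<Longrightarrow>
      appl M (appl M (appl M s x) y) z = appl M (appl M x z) (appl M y z)"
  shows "s \<in> C_eq M (X \<rightarrow>\<^sub>f Y \<rightarrow>\<^sub>f Z)"
proof (rule C_eqI[OF s])
  have covs: "Y \<rightarrow>\<^sub>f Z \<in> covered M" "X \<in> covered M" "Y \<in> covered M" "Z \<in> covered M"
    using covered_fun[OF cov] covered_fun[of Y Z] by blast+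
  then have covX: "\<rho> \<rightarrow>\<^sub>f \<sigma> \<rightarrow>\<^sub>f \<tau> \<in> covered M" "\<sigma> \<rightarrow>\<^sub>f \<tau> \<in> covered M"
    and covY: "\<rho> \<rightarrow>\<^sub>f \<sigma> \<in> covered M" and covZ: "\<rho> \<rightarrow>\<^sub>f \<tau> \<in> covered M"
    unfolding X_def Y_def Z_def using covered_fun by blast+
  define v where "v c e = pos M \<sigma> c e" for c e
  define u where "u a e = pos M (\<sigma> \<rightarrow>\<^sub>f \<tau>) a e" for a e
  \<comment> \<open>The tests on y z that x z demands of its argument when the result is tested at
    \<open>d\<close>.\<close>
  define B where "B a c e d = neg M \<tau> (u a e) (v c e) d" for a c e d
  define F\<^sub>3 where "F\<^sub>3 a c e = pos M \<tau> (u a e) (v c e)" for a c e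
  \<comment> \<open>z is used inside x z for the test \<open>v c e @ d\<close>, and inside y z once
    for every test in \<open>B\<close>. The outcome is a finite union of boxes and in general not a
    box.\<close>
  define G\<^sub>3 where "G\<^sub>3 a c e d = neg M (\<sigma> \<rightarrow>\<^sub>f \<tau>) a e (v c e @ d) \<union> (\<Union>b\<in>B a c e d. neg M \<sigma> c e b)"
    for a c e d
  define F\<^sub>2 where "F\<^sub>2 a c = mk \<rho> \<tau> (F\<^sub>3 a c) (G\<^sub>3 a c)" for a c
  \<comment> \<open>A test \<open>b\<close> on y z comes from the test \<open>e @ b\<close> on
    y.\<close>
  define G\<^sub>2 where "G\<^sub>2 a c ed = (let e = take (length (tpos \<rho>)) ed; d = drop (length (tpos \<rho>)) ed
    in (\<lambda>b. e @ b) ` B a c e d)" for a c ed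
  define F\<^sub>1 where "F\<^sub>1 a = mk Y Z (F\<^sub>2 a) (G\<^sub>2 a)" for a
  \<comment> \<open>x is tested only once, so that x z passes the test
    \<open>v c e @ d\<close>.\<close>
  define G\<^sub>1 where "G\<^sub>1 a ced = (let c = take (length (tpos Y)) ced; ed = drop (length (tpos Y)) ced;
    e = take (length (tpos \<rho>)) ed; d = drop (length (tpos \<rho>)) ed in {e @ v c e @ d})"
    for a :: "'u list" and ced
  have G\<^sub>2_eq: "G\<^sub>2 a c (e @ d) = (\<lambda>b. e @ b) ` B a c e d" if "e \<in> tuples M (tpos \<rho>)" for a c e d
    by (simp add: G\<^sub>2_def length_tuples[OF that])
  have G\<^sub>1_eq: "G\<^sub>1 a (c @ e @ d) = {e @ v c e @ d}"
    if "c \<in> tuples M (tpos Y)" "e \<in> tuples M (tpos \<rho>)" for a c e d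
    by (simp add: G\<^sub>1_def length_tuples[OF that(1)] length_tuples[OF that(2)])
  have v: "v c e \<in> tuples M (tpos \<sigma>)" if "c \<in> tuples M (tpos Y)" "e \<in> tuples M (tpos \<rho>)" for c e
    using that unfolding v_def Y_def by (intro pos_tuples[OF covY])
  have u: "u a e \<in> tuples M (tpos (\<sigma> \<rightarrow>\<^sub>f \<tau>))"
    if "a \<in> tuples M (tpos X)" "e \<in> tuples M (tpos \<rho>)" for a e
    using that unfolding u_def X_def by (intro pos_tuples[OF covX(1)])
  have B: "B a c e d \<subseteq> tuples M (tneg \<sigma>)" "finite (B a c e d)"
    if "a \<in> tuples M (tpos X)" "c \<in> tuples M (tpos Y)" "e \<in> tuples M (tpos \<rho>)"
      "d \<in> tuples M (tneg \<tau>)" for a c e d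
    unfolding B_def
    using neg_tuples[OF covX(2) u v] finite_neg[OF covX(2) u v] that by blast+
  have F\<^sub>3: "F\<^sub>3 a c e \<in> tuples M (tpos \<tau>)"
    if "a \<in> tuples M (tpos X)" "c \<in> tuples M (tpos Y)" "e \<in> tuples M (tpos \<rho>)" for a c e
    unfolding F\<^sub>3_def using that by (intro pos_tuples[OF covX(2)] u v)
  have G\<^sub>3: "finite (G\<^sub>3 a c e d) \<and> G\<^sub>3 a c e d \<subseteq> tuples M (tneg \<rho>)"
    if a: "a \<in> tuples M (tpos X)" and c: "c \<in> tuples M (tpos Y)" and e: "e \<in> tuples M (tpos \<rho>)"
      and d: "d \<in> tuples M (tneg \<tau>)" for a c e d
  proof -
    have vd: "v c e @ d \<in> tuples M (tneg (\<sigma> \<rightarrow>\<^sub>f \<tau>))" by (intro tneg_funI v c e d)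
    show ?thesis
      unfolding G\<^sub>3_def
      using neg_tuples[OF covX(1) a[unfolded X_def] e vd] finite_neg[OF covX(1) a[unfolded X_def] e vd]
        neg_tuples[OF covY c[unfolded Y_def] e] finite_neg[OF covY c[unfolded Y_def] e]
        B[OF a c e d]
      by (intro conjI finite_UnI finite_UN_I Un_least UN_least) blast+
  qed
  have F\<^sub>2: "F\<^sub>2 a c \<in> tuples M (tpos Z)" if "a \<in> tuples M (tpos X)" "c \<in> tuples M (tpos Y)" for a c
    unfolding F\<^sub>2_def Z_def using that by (intro mk_tuples[OF covZ] F\<^sub>3 G\<^sub>3)
  have G\<^sub>2: "finite (G\<^sub>2 a c ed) \<and> G\<^sub>2 a c ed \<subseteq> tuples M (tneg Y)"
    if a: "a \<in> tuples M (tpos X)" and c: "c \<in> tuples M (tpos Y)" and "ed \<in> tuples M (tneg Z)" for a c ed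
  proof -
    obtain e d where ed: "ed = e @ d" and e: "e \<in> tuples M (tpos \<rho>)" and d: "d \<in> tuples M (tneg \<tau>)"
      using \<open>ed \<in> _\<close> unfolding Z_def by (elim tneg_funE)
    show ?thesis
      unfolding ed G\<^sub>2_eq[OF e] Y_def using B[OF a c e d] e by (auto intro!: tneg_funI simp del: tneg.simps)
  qed
  have F\<^sub>1: "F\<^sub>1 a \<in> tuples M (tpos (Y \<rightarrow>\<^sub>f Z))" if "a \<in> tuples M (tpos X)" for a
    unfolding F\<^sub>1_def using that by (intro mk_tuples[OF covs(1)] F\<^sub>2 G\<^sub>2)
  have G\<^sub>1: "finite (G\<^sub>1 a ced) \<and> G\<^sub>1 a ced \<subseteq> tuples M (tneg X)"
    if ced: "ced \<in> tuples M (tneg (Y \<rightarrow>\<^sub>f Z))" for a ced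
  proof -
    obtain c e d where ced_eq: "ced = c @ e @ d" and c: "c \<in> tuples M (tpos Y)"
      and e: "e \<in> tuples M (tpos \<rho>)" and d: "d \<in> tuples M (tneg \<tau>)"
      using ced unfolding Z_def by (elim tneg_funE) blast
    show ?thesis
      unfolding ced_eq G\<^sub>1_eq[OF c e] X_def using tneg_funI[OF e tneg_funI[OF v[OF c e] d]] by blast
  qed
  show "mk X (Y \<rightarrow>\<^sub>f Z) F\<^sub>1 G\<^sub>1 \<in> tuples M (tpos (X \<rightarrow>\<^sub>f Y \<rightarrow>\<^sub>f Z))"
    by (rule mk_tuples[OF cov F\<^sub>1 G\<^sub>1])
  fix aced assume "aced \<in> tuples M (tneg (X \<rightarrow>\<^sub>f Y \<rightarrow>\<^sub>f Z))"
  then obtain a c e d where aced: "aced = a @ c @ e @ d" and a: "a \<in> tuples M (tpos X)"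
    and c: "c \<in> tuples M (tpos Y)" and e: "e \<in> tuples M (tpos \<rho>)" and d: "d \<in> tuples M (tneg \<tau>)"
    unfolding Z_def by (elim tneg_funE) blast
  have ed: "e @ d \<in> tuples M (tneg Z)" unfolding Z_def by (rule tneg_funI[OF e d])
  note ced = tneg_funI[OF c ed]
  show "interp M (X \<rightarrow>\<^sub>f Y \<rightarrow>\<^sub>f Z) s (mk X (Y \<rightarrow>\<^sub>f Z) F\<^sub>1 G\<^sub>1) aced"
    unfolding aced
  proof (rule interp_mk[OF cov F\<^sub>1 G\<^sub>1 a ced])
    fix x assume x: "x \<in> carr M (sty_of X)" "\<forall>b\<in>G\<^sub>1 a (c @ e @ d). interp M X x a b"
    then have x': "interp M (\<rho> \<rightarrow>\<^sub>f \<sigma> \<rightarrow>\<^sub>f \<tau>) x a (e @ v c e @ d)" by (simp add: G\<^sub>1_eq[OF c e] X_def)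
    show "interp M (Y \<rightarrow>\<^sub>f Z) (appl M s x) (F\<^sub>1 a) (c @ e @ d)"
      unfolding F\<^sub>1_def
    proof (rule interp_mk[OF covs(1) F\<^sub>2[OF a] G\<^sub>2[OF a] c ed])
      fix y assume y: "y \<in> carr M (sty_of Y)" "\<forall>b\<in>G\<^sub>2 a c (e @ d). interp M Y y c b"
      then have y': "interp M (\<rho> \<rightarrow>\<^sub>f \<sigma>) y c (e @ b)" if "b \<in> B a c e d" for b
        using that by (simp add: G\<^sub>2_eq[OF e] Y_def)
      show "interp M Z (appl M (appl M s x) y) (F\<^sub>2 a c) (e @ d)"
        unfolding F\<^sub>2_def Z_def
      proof (rule interp_mk[OF covZ F\<^sub>3[OF a c] G\<^sub>3[OF a c] e d])
        fix z assume z: "z \<in> carr M (sty_of \<rho>)" "\<forall>b\<in>G\<^sub>3 a c e d. interp M \<rho> z e b"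
        \<comment> \<open>The second part of \<open>G\<^sub>3\<close> makes y z pass all tests in
          \<open>B\<close>, and the first part makes x z pass \<open>v c e @ d\<close>; these are
          the premises for applying x z to y z.\<close>
        have "interp M \<sigma> (appl M y z) (v c e) b" if b: "b \<in> B a c e d" for b
          using interp_appl[OF y'[OF b] e z(1)] z(2) b unfolding v_def G\<^sub>3_def by blast
        moreover have "interp M (\<sigma> \<rightarrow>\<^sub>f \<tau>) (appl M x z) (u a e) (v c e @ d)"
          using interp_appl[OF x' e z(1)] z(2) unfolding u_def G\<^sub>3_def by blast
        moreover have "appl M y z \<in> carr M (sty_of \<sigma>)"
          using appl_carr[OF covered_fun(3)[OF covY]] y(1) z(1) by (simp add: Y_def)
        ultimately have "interp M \<tau> (appl M (appl M x z) (appl M y z)) (F\<^sub>3 a c e) d"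
          using interp_appl[OF _ v[OF c e]] unfolding F\<^sub>3_def B_def by blast
        then show "interp M \<tau> (appl M (appl M (appl M s x) y) z) (F\<^sub>3 a c e) d"
          using x(1) y(1) z(1) by (simp add: eq)
      qed
    qed
  qed
qed

text \<open>Here \<open>r\<close> and \<open>r'\<close> stand for R n and R (n + 1) with
  \<open>n\<close> fixed. If \<open>a\<close> belongs to w and \<open>c\<close> to f, then
  \<open>q a\<close> belongs to R n w, \<open>v a c\<close> to R n w f, \<open>p c\<close> to f n,
  and \<open>F\<^sub>2\<close> to f n (R n w f). A test \<open>d\<close> on the result needs f n at
  \<open>v a c @ d\<close> and R n w f at each test in \<open>B\<close>; the latter are traced back
  through the realiser \<open>as\<close> of \<open>r\<close>.\<close>

lemma R_step_C_eq:
  fixes \<sigma>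
  defines "\<phi> \<equiv> NatT \<rightarrow>\<^sub>f \<sigma> \<rightarrow>\<^sub>f \<sigma>"
  assumes r: "r \<in> C_eq M (\<sigma> \<rightarrow>\<^sub>f \<phi> \<rightarrow>\<^sub>f \<sigma>)"
    and cov: "\<sigma> \<rightarrow>\<^sub>f \<phi> \<rightarrow>\<^sub>f \<sigma> \<in> covered M" and r': "r' \<in> carr M (sty_of (\<sigma> \<rightarrow>\<^sub>f \<phi> \<rightarrow>\<^sub>f \<sigma>))"
    and eq: "\<And>w f. w \<in> carr M (sty_of \<sigma>) \<Longrightarrow> f \<in> carr M (sty_of \<phi>) \<Longrightarrow>
      appl M (appl M r' w) f = appl M (appl M f (num_val M n)) (appl M (appl M r w) f)"
  shows "r' \<in> C_eq M (\<sigma> \<rightarrow>\<^sub>f \<phi> \<rightarrow>\<^sub>f \<sigma>)"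
proof -
  obtain as where as: "as \<in> tuples M (tpos (\<sigma> \<rightarrow>\<^sub>f \<phi> \<rightarrow>\<^sub>f \<sigma>))"
    "\<And>b. b \<in> tuples M (tneg (\<sigma> \<rightarrow>\<^sub>f \<phi> \<rightarrow>\<^sub>f \<sigma>)) \<Longrightarrow> interp M (\<sigma> \<rightarrow>\<^sub>f \<phi> \<rightarrow>\<^sub>f \<sigma>) r as b"
    using r unfolding C_eq_def by blast
  have cov\<phi>: "\<phi> \<rightarrow>\<^sub>f \<sigma> \<in> covered M" using covered_fun[OF cov] by blast
  then have covf: "NatT \<rightarrow>\<^sub>f \<sigma> \<rightarrow>\<^sub>f \<sigma> \<in> covered M" "\<sigma> \<rightarrow>\<^sub>f \<sigma> \<in> covered M"
    unfolding \<phi>_def using covered_fun by blast+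
  let ?n = "[num_val M n]"
  have n: "?n \<in> tuples M (tpos NatT)" by (simp add: in_tuples_iff)
  define q where "q a = pos M (\<phi> \<rightarrow>\<^sub>f \<sigma>) as a" for a
  define v where "v a c = pos M \<sigma> (q a) c" for a c
  define p where "p c = pos M (\<sigma> \<rightarrow>\<^sub>f \<sigma>) c ?n" for c
  define B where "B a c d = neg M \<sigma> (p c) (v a c) d" for a c d
  define F\<^sub>2 where "F\<^sub>2 a c = pos M \<sigma> (p c) (v a c)" for a c
  \<comment> \<open>f is used directly, as f n (R n w f), and again inside R n w f for each test in
    \<open>B\<close>.\<close>
  define G\<^sub>2 where "G\<^sub>2 a c d = insert (?n @ v a c @ d) (\<Union>b\<in>B a c d. neg M \<sigma> (q a) c b)" for a c d
  define F\<^sub>1 where "F\<^sub>1 a = mk \<phi> \<sigma> (F\<^sub>2 a) (G\<^sub>2 a)" for a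
  \<comment> \<open>w occurs only inside R n w f. A test \<open>b\<close> on that value is a test
    \<open>c @ b\<close> on R n w, for which \<open>as\<close> bounds the tests on w.\<close>
  define G\<^sub>1 where "G\<^sub>1 a cd = (let c = take (length (tpos \<phi>)) cd; d = drop (length (tpos \<phi>)) cd
    in \<Union>b\<in>B a c d. neg M (\<phi> \<rightarrow>\<^sub>f \<sigma>) as a (c @ b))" for a cd
  have G\<^sub>1_eq: "G\<^sub>1 a (c @ d) = (\<Union>b\<in>B a c d. neg M (\<phi> \<rightarrow>\<^sub>f \<sigma>) as a (c @ b))"
    if "c \<in> tuples M (tpos \<phi>)" for a c d
    by (simp add: G\<^sub>1_def length_tuples[OF that])
  have q: "q a \<in> tuples M (tpos (\<phi> \<rightarrow>\<^sub>f \<sigma>))" if "a \<in> tuples M (tpos \<sigma>)" for a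
    unfolding q_def using that by (intro pos_tuples[OF cov] as)
  have v: "v a c \<in> tuples M (tpos \<sigma>)" if "a \<in> tuples M (tpos \<sigma>)" "c \<in> tuples M (tpos \<phi>)" for a c
    unfolding v_def using that by (intro pos_tuples[OF cov\<phi>] q)
  have p: "p c \<in> tuples M (tpos (\<sigma> \<rightarrow>\<^sub>f \<sigma>))" if "c \<in> tuples M (tpos \<phi>)" for c
    unfolding p_def using that unfolding \<phi>_def by (intro pos_tuples[OF covf(1)] n)
  have B: "B a c d \<subseteq> tuples M (tneg \<sigma>)" "finite (B a c d)"
    if "a \<in> tuples M (tpos \<sigma>)" "c \<in> tuples M (tpos \<phi>)" "d \<in> tuples M (tneg \<sigma>)" for a c d
    unfolding B_def using neg_tuples[OF covf(2) p v] finite_neg[OF covf(2) p v] that by blast+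
  have F\<^sub>2: "F\<^sub>2 a c \<in> tuples M (tpos \<sigma>)"
    if "a \<in> tuples M (tpos \<sigma>)" "c \<in> tuples M (tpos \<phi>)" for a c
    unfolding F\<^sub>2_def using that by (intro pos_tuples[OF covf(2)] p v)
  have G\<^sub>2: "finite (G\<^sub>2 a c d) \<and> G\<^sub>2 a c d \<subseteq> tuples M (tneg \<phi>)"
    if a: "a \<in> tuples M (tpos \<sigma>)" and c: "c \<in> tuples M (tpos \<phi>)" and d: "d \<in> tuples M (tneg \<sigma>)"
    for a c d
  proof -
    have "?n @ v a c @ d \<in> tuples M (tneg \<phi>)"
      unfolding \<phi>_def by (rule tneg_funI[OF n tneg_funI[OF v[OF a c] d]])
    then show ?thesis
      unfolding G\<^sub>2_def
      using neg_tuples[OF cov\<phi> q[OF a] c] finite_neg[OF cov\<phi> q[OF a] c] B[OF a c d] by blast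
  qed
  have F\<^sub>1: "F\<^sub>1 a \<in> tuples M (tpos (\<phi> \<rightarrow>\<^sub>f \<sigma>))" if "a \<in> tuples M (tpos \<sigma>)" for a
    unfolding F\<^sub>1_def using that by (intro mk_tuples[OF cov\<phi>] F\<^sub>2 G\<^sub>2)
  have G\<^sub>1: "finite (G\<^sub>1 a cd) \<and> G\<^sub>1 a cd \<subseteq> tuples M (tneg \<sigma>)"
    if a: "a \<in> tuples M (tpos \<sigma>)" and "cd \<in> tuples M (tneg (\<phi> \<rightarrow>\<^sub>f \<sigma>))" for a cd
  proof -
    obtain c d where cd: "cd = c @ d" and c: "c \<in> tuples M (tpos \<phi>)" and d: "d \<in> tuples M (tneg \<sigma>)"
      using \<open>cd \<in> _\<close> by (elim tneg_funE)
    show ?thesis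
      unfolding cd G\<^sub>1_eq[OF c]
      using neg_tuples[OF cov as(1) a tneg_funI[OF c]] finite_neg[OF cov as(1) a tneg_funI[OF c]]
        B[OF a c d] by blast
  qed
  show ?thesis
  proof (rule C_eqI[OF r'])
    show "mk \<sigma> (\<phi> \<rightarrow>\<^sub>f \<sigma>) F\<^sub>1 G\<^sub>1 \<in> tuples M (tpos (\<sigma> \<rightarrow>\<^sub>f \<phi> \<rightarrow>\<^sub>f \<sigma>))"
      by (rule mk_tuples[OF cov F\<^sub>1 G\<^sub>1])
    fix acd assume "acd \<in> tuples M (tneg (\<sigma> \<rightarrow>\<^sub>f \<phi> \<rightarrow>\<^sub>f \<sigma>))"
    then obtain a c d where acd: "acd = a @ c @ d" and a: "a \<in> tuples M (tpos \<sigma>)"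
      and c: "c \<in> tuples M (tpos \<phi>)" and d: "d \<in> tuples M (tneg \<sigma>)"
      by (elim tneg_funE) blast
    note cd = tneg_funI[OF c d]
    show "interp M (\<sigma> \<rightarrow>\<^sub>f \<phi> \<rightarrow>\<^sub>f \<sigma>) r' (mk \<sigma> (\<phi> \<rightarrow>\<^sub>f \<sigma>) F\<^sub>1 G\<^sub>1) acd"
      unfolding acd
    proof (rule interp_mk[OF cov F\<^sub>1 G\<^sub>1 a cd])
      fix w assume w: "w \<in> carr M (sty_of \<sigma>)" "\<forall>b\<in>G\<^sub>1 a (c @ d). interp M \<sigma> w a b"
      have rw: "interp M (\<phi> \<rightarrow>\<^sub>f \<sigma>) (appl M r w) (q a) (c @ b)" if b: "b \<in> B a c d" for b
      proof -
        have "b \<in> tuples M (tneg \<sigma>)" using B[OF a c d] b by blast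
        from interp_appl[OF as(2)[OF tneg_funI[OF a tneg_funI[OF c this]]] a w(1)] w(2) b
        show ?thesis unfolding q_def G\<^sub>1_eq[OF c] by blast
      qed
      show "interp M (\<phi> \<rightarrow>\<^sub>f \<sigma>) (appl M r' w) (F\<^sub>1 a) (c @ d)"
        unfolding F\<^sub>1_def
      proof (rule interp_mk[OF cov\<phi> F\<^sub>2[OF a] G\<^sub>2[OF a] c d])
        fix f assume f: "f \<in> carr M (sty_of \<phi>)" "\<forall>b\<in>G\<^sub>2 a c d. interp M \<phi> f c b"
        have "interp M \<sigma> (appl M (appl M r w) f) (v a c) b" if b: "b \<in> B a c d" for b
          using interp_appl[OF rw[OF b] c f(1)] f(2) b unfolding v_def G\<^sub>2_def by blast
        moreover have "interp M (\<sigma> \<rightarrow>\<^sub>f \<sigma>) (appl M f (num_val M n)) (p c) (v a c @ d)"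
        proof -
          have "interp M (NatT \<rightarrow>\<^sub>f \<sigma> \<rightarrow>\<^sub>f \<sigma>) f c (?n @ v a c @ d)"
            using f(2) unfolding G\<^sub>2_def \<phi>_def by blast
          \<comment> \<open>Lower tuples at \<open>NatT\<close> are empty, so the number, having
            itself as upper tuple, passes every test in this box.\<close>
          moreover have "neg M (\<sigma> \<rightarrow>\<^sub>f \<sigma>) c ?n (v a c @ d) \<subseteq> tuples M (tneg NatT)"
            using neg_tuples[OF covf(1) _ n tneg_funI[OF v[OF a c] d]] c unfolding \<phi>_def by blast
          ultimately show ?thesis
            unfolding p_def by (intro interp_appl[OF _ n]) auto
        qed
        moreover have "appl M (appl M r w) f \<in> carr M (sty_of \<sigma>)"
          using appl_carr[OF covered_fun(3)[OF cov]] appl_carr[OF covered_fun(3)[OF cov\<phi>]]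
            C_eq_carr[OF r] w(1) f(1) by simp
        ultimately have "interp M \<sigma> (appl M (appl M f (num_val M n)) (appl M (appl M r w) f)) (F\<^sub>2 a c) d"
          using interp_appl[OF _ v[OF a c]] unfolding F\<^sub>2_def B_def by blast
        then show "interp M \<sigma> (appl M (appl M r' w) f) (F\<^sub>2 a c) d"
          using w(1) f(1) by (simp add: eq)
      qed
    qed
  qed
qed

section \<open>The constants of T inside the full structure\<close>

lemma ex_K:
  assumes cov: "\<rho> \<rightarrow>\<^sub>f \<sigma> \<rightarrow>\<^sub>f \<rho> \<in> covered M"
  shows "\<exists>k\<in>C_eq M (\<rho> \<rightarrow>\<^sub>f \<sigma> \<rightarrow>\<^sub>f \<rho>).
    \<forall>x\<in>carr M (sty_of \<rho>). \<forall>y\<in>carr M (sty_of \<sigma>). appl M (appl M k x) y = x"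
proof -
  let ?\<rho> = "sty_of \<rho>" and ?\<sigma> = "sty_of \<sigma>"
  have t: "?\<rho> \<rightarrow>\<^sub>s ?\<sigma> \<rightarrow>\<^sub>s ?\<rho> \<in> \<T>" "?\<sigma> \<rightarrow>\<^sub>s ?\<rho> \<in> \<T>"
    using covered_fun(3)[OF cov] covered_fun(3)[OF covered_fun(2)[OF cov]] by simp_all
  let ?k = "lam ?\<rho> (?\<sigma> \<rightarrow>\<^sub>s ?\<rho>) (\<lambda>x. lam ?\<sigma> ?\<rho> (\<lambda>_. x))"
  have "?k \<in> carr M (sty_of (\<rho> \<rightarrow>\<^sub>f \<sigma> \<rightarrow>\<^sub>f \<rho>))"
    by (simp add: lam_carr t)
  moreover have "appl M (appl M ?k x) y = x" if "x \<in> carr M ?\<rho>" "y \<in> carr M ?\<sigma>" for x y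
    using that by (simp add: appl_lam lam_carr t)
  ultimately show ?thesis by (intro bexI[of _ ?k] ballI K_C_eq[OF cov])
qed

lemma ex_S:
  assumes cov: "(\<rho> \<rightarrow>\<^sub>f \<sigma> \<rightarrow>\<^sub>f \<tau>) \<rightarrow>\<^sub>f (\<rho> \<rightarrow>\<^sub>f \<sigma>) \<rightarrow>\<^sub>f \<rho> \<rightarrow>\<^sub>f \<tau> \<in> covered M"
  shows "\<exists>s\<in>C_eq M ((\<rho> \<rightarrow>\<^sub>f \<sigma> \<rightarrow>\<^sub>f \<tau>) \<rightarrow>\<^sub>f (\<rho> \<rightarrow>\<^sub>f \<sigma>) \<rightarrow>\<^sub>f \<rho> \<rightarrow>\<^sub>f \<tau>).
    \<forall>x\<in>carr M (sty_of (\<rho> \<rightarrow>\<^sub>f \<sigma> \<rightarrow>\<^sub>f \<tau>)). \<forall>y\<in>carr M (sty_of (\<rho> \<rightarrow>\<^sub>f \<sigma>)). \<forall>z\<in>carr M (sty_of \<rho>).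
      appl M (appl M (appl M s x) y) z = appl M (appl M x z) (appl M y z)"
proof -
  let ?\<rho> = "sty_of \<rho>" and ?\<sigma> = "sty_of \<sigma>" and ?\<tau> = "sty_of \<tau>"
  let ?X = "?\<rho> \<rightarrow>\<^sub>s ?\<sigma> \<rightarrow>\<^sub>s ?\<tau>" and ?Y = "?\<rho> \<rightarrow>\<^sub>s ?\<sigma>" and ?Z = "?\<rho> \<rightarrow>\<^sub>s ?\<tau>"
  have t: "?X \<rightarrow>\<^sub>s ?Y \<rightarrow>\<^sub>s ?Z \<in> \<T>" using covered_fun(3)[OF cov] by simp
  have YZ: "?Y \<rightarrow>\<^sub>s ?Z \<in> \<T>" and X: "?X \<in> \<T>" using types_fun[OF t] by simp_all
  have t': "?Y \<in> \<T>" "?Z \<in> \<T>" "?\<sigma> \<rightarrow>\<^sub>s ?\<tau> \<in> \<T>"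
    using types_fun[OF YZ] types_fun[OF X] by simp_all
  let ?h = "\<lambda>x y z. appl M (appl M x z) (appl M y z)"
  have h: "?h x y z \<in> carr M ?\<tau>" if "x \<in> carr M ?X" "y \<in> carr M ?Y" "z \<in> carr M ?\<rho>" for x y z
    using that by (intro appl_carr[OF t'(3)] appl_carr[OF X] appl_carr[OF t'(1)])
  let ?s = "lam ?X (?Y \<rightarrow>\<^sub>s ?Z) (\<lambda>x. lam ?Y ?Z (\<lambda>y. lam ?\<rho> ?\<tau> (?h x y)))"
  have "?s \<in> carr M (?X \<rightarrow>\<^sub>s ?Y \<rightarrow>\<^sub>s ?Z)"
    by (intro lam_carr t YZ t' h)
  moreover have "appl M (appl M (appl M ?s x) y) z = ?h x y z"
    if "x \<in> carr M ?X" "y \<in> carr M ?Y" "z \<in> carr M ?\<rho>" for x y z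
    using that by (simp add: appl_lam lam_carr t YZ t' h)
  ultimately show ?thesis by (intro bexI[of _ ?s] ballI S_C_eq[OF cov]) simp_all
qed

lemma ex_Suc:
  assumes cov: "NatT \<rightarrow>\<^sub>f NatT \<in> covered M"
  shows "\<exists>s\<in>C_eq M (NatT \<rightarrow>\<^sub>f NatT). \<forall>n. appl M s (num_val M n) = num_val M (Suc n)"
proof -
  have t: "NatS \<rightarrow>\<^sub>s NatS \<in> \<T>" using covered_fun(3)[OF cov] by simp
  \<comment> \<open>\<open>inv (num_val M)\<close> decodes an element of the carrier of
    numbers.\<close>
  let ?h = "\<lambda>x. num_val M (Suc (inv (num_val M) x))"
  obtain s where s: "s \<in> carr M (NatS \<rightarrow>\<^sub>s NatS)" "\<forall>x\<in>carr M NatS. appl M s x = ?h x"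
    using ex_fun[OF t, of ?h] by auto
  have "inj (num_val M)" by (simp add: inj_def)
  then have "appl M s (num_val M n) = num_val M (Suc n)" for n
    using s(2) by simp
  \<comment> \<open>Any function on the numbers qualifies here, since each of its values is realised
    by itself.\<close>
  moreover from this have "s \<in> C_eq M (NatT \<rightarrow>\<^sub>f NatT)"
    using s(1) by (intro fun_NatT_C_eqI cov) (simp_all add: C_eq_NatT)
  ultimately show ?thesis by blast
qed

lemma ex_R:
  assumes cov: "NatT \<rightarrow>\<^sub>f \<sigma> \<rightarrow>\<^sub>f (NatT \<rightarrow>\<^sub>f \<sigma> \<rightarrow>\<^sub>f \<sigma>) \<rightarrow>\<^sub>f \<sigma> \<in> covered M"
  shows "\<exists>r\<in>C_eq M (NatT \<rightarrow>\<^sub>f \<sigma> \<rightarrow>\<^sub>f (NatT \<rightarrow>\<^sub>f \<sigma> \<rightarrow>\<^sub>f \<sigma>) \<rightarrow>\<^sub>f \<sigma>).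
    \<forall>w\<in>carr M (sty_of \<sigma>). \<forall>f\<in>carr M (sty_of (NatT \<rightarrow>\<^sub>f \<sigma> \<rightarrow>\<^sub>f \<sigma>)).
      appl M (appl M (appl M r (num_val M 0)) w) f = w \<and>
      (\<forall>n. appl M (appl M (appl M r (num_val M (Suc n))) w) f =
        appl M (appl M f (num_val M n)) (appl M (appl M (appl M r (num_val M n)) w) f))"
proof -
  define \<phi> where "\<phi> = NatT \<rightarrow>\<^sub>f \<sigma> \<rightarrow>\<^sub>f \<sigma>"
  let ?\<sigma> = "sty_of \<sigma>" and ?\<phi> = "sty_of \<phi>"
  let ?\<tau> = "?\<sigma> \<rightarrow>\<^sub>s ?\<phi> \<rightarrow>\<^sub>s ?\<sigma>"
  note cov1 = covered_fun(2)[OF cov, folded \<phi>_def]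
  note cov2 = covered_fun(2)[OF cov1]
  note cov3 = covered_fun(1)[OF cov2, unfolded \<phi>_def]
  note cov4 = covered_fun(2)[OF cov3]
  have t: "NatS \<rightarrow>\<^sub>s ?\<tau> \<in> \<T>" "?\<tau> \<in> \<T>" "?\<phi> \<rightarrow>\<^sub>s ?\<sigma> \<in> \<T>" "NatS \<rightarrow>\<^sub>s ?\<sigma> \<rightarrow>\<^sub>s ?\<sigma> \<in> \<T>" "?\<sigma> \<rightarrow>\<^sub>s ?\<sigma> \<in> \<T>"
    using covered_fun(3)[OF cov] covered_fun(3)[OF cov1] covered_fun(3)[OF cov2]
      covered_fun(3)[OF cov3] covered_fun(3)[OF cov4] by (simp_all add: \<phi>_def)
  \<comment> \<open>The value R n w f, computed by recursion on \<open>n\<close> outside the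
    structure.\<close>
  let ?val = "\<lambda>w f. rec_nat w (\<lambda>m. appl M (appl M f (num_val M m)))"
  have val: "?val w f n \<in> carr M ?\<sigma>" if w: "w \<in> carr M ?\<sigma>" and f: "f \<in> carr M ?\<phi>" for w f n
  proof (induction n)
    case (Suc n)
    have "appl M f (num_val M n) \<in> carr M (?\<sigma> \<rightarrow>\<^sub>s ?\<sigma>)"
      using f by (intro appl_carr[OF t(4)]) (simp_all add: \<phi>_def)
    from appl_carr[OF t(5) this Suc] show ?case by simp
  qed (simp add: w)
  \<comment> \<open>R n as a function of w and f only. Keeping \<open>n\<close> external allows
    membership in \<open>C_eq\<close> to be shown by induction on it.\<close>
  define rn where "rn n = lam ?\<sigma> (?\<phi> \<rightarrow>\<^sub>s ?\<sigma>) (\<lambda>w. lam ?\<phi> ?\<sigma> (\<lambda>f. ?val w f n))" for n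
  have rn: "rn n \<in> carr M ?\<tau>" for n
    unfolding rn_def by (intro lam_carr t val)
  have appl_rn: "appl M (appl M (rn n) w) f = ?val w f n"
    if "w \<in> carr M ?\<sigma>" "f \<in> carr M ?\<phi>" for n w f
    unfolding rn_def using that by (simp add: appl_lam lam_carr t val)
  have rn_C_eq: "rn n \<in> C_eq M (\<sigma> \<rightarrow>\<^sub>f \<phi> \<rightarrow>\<^sub>f \<sigma>)" for n
  proof (induction n)
    case 0
    \<comment> \<open>R 0 w f = w is the defining equation of K at these types.\<close>
    show ?case using rn by (intro K_C_eq cov1) (simp_all add: appl_rn)
  next
    case (Suc n)
    show ?case
      using rn unfolding \<phi>_def
      by (intro R_step_C_eq[OF Suc[unfolded \<phi>_def] cov1[unfolded \<phi>_def]])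
        (simp_all add: appl_rn flip: \<phi>_def)
  qed
  \<comment> \<open>Joins the objects \<open>rn n\<close> into one function of the number; by
    \<open>fun_NatT_C_eqI\<close> their realisers may be unrelated for different
    \<open>n\<close>.\<close>
  obtain r where r: "r \<in> carr M (NatS \<rightarrow>\<^sub>s ?\<tau>)" "\<forall>x\<in>carr M NatS. appl M r x = rn (inv (num_val M) x)"
    using ex_fun[OF t(1), of "\<lambda>x. rn (inv (num_val M) x)"] rn by auto
  have "inj (num_val M)" by (simp add: inj_def)
  then have appl_r: "appl M r (num_val M n) = rn n" for n
    using r(2) by simp
  have "r \<in> C_eq M (NatT \<rightarrow>\<^sub>f \<sigma> \<rightarrow>\<^sub>f \<phi> \<rightarrow>\<^sub>f \<sigma>)"
    using r(1) cov rn_C_eq by (intro fun_NatT_C_eqI) (simp_all add: appl_r \<phi>_def)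
  then show ?thesis
    unfolding \<phi>_def[symmetric] using appl_r appl_rn by (intro bexI[of _ r]) simp_all
qed

end

theorem proposition7p9:
  fixes M :: "'u type_structure"
  assumes "full_structure M"
  shows "model_of_T M (covered M) (C_eq M)"
proof -
  interpret full_type_structure M by unfold_locales (rule assms)
  show ?thesis
    unfolding model_of_T_def
    using appl_C_eq ex_K ex_S ex_Suc ex_R
    by (intro conjI ballI allI impI subsetI C_eq_NatT) (auto simp: C_eq_NatT C_eq_carr simp del: sty_of.simps)
qed

end
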